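(* Let $K$ be a field, $G$ a finite group and $\mathcal{C}\leq KG$ a $G$-code such that $\mathcal{C}\nsubseteq\mathcal{C}^{\perp}$. Then $\mathcal{C}*\mathcal{C}=\mathcal{P}_0\oplus\mathcal{M}$, where $\mathcal{P}_0$ and $\mathcal{M}$ are $KG$-modules and $\mathcal{P}_0$ is a projective cover of the trivial $KG$-module $K_G$. In particular, if $\mathrm{char}\,K=p$ is a prime, then $|G|_p\leq\dim(\mathcal{C}*\mathcal{C})$.
   Context: $KG$ is the group algebra of $G$ over $K$; modules are right modules. A $G$-code over $K$ is a right ideal $\mathcal{C}$ of $KG$ (written $\mathcal{C}\leq KG$). The Schur product on $KG$ is the componentwise product $\left(\sum_{g}a_g g\right)*\left(\sum_g b_g g\right)=\sum_g a_gb_g\, g$, and $\mathcal{C}*\mathcal{C}$ is the $K$-linear span of $\{c*c'\mid c,c'\in\mathcal{C}\}$; it is again a right ideal of $KG$. The standard inner product on $KG$ is $\langle\sum_g a_g g,\sum_g b_g g\rangle=\sum_g a_gb_g$, and $\mathcal{C}^\perp=\{v\in KG\mid\langle v,c\rangle=0\text{ for all }c\in\mathcal{C}\}$. The direct sum decomposition is understood up to $KG$-isomorphism of the summands. $|G|_p\geq 1$ is the largest power of $p$ dividing $|G|$. *)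

theory Defs
  imports
    Complex_Main
    "HOL-Algebra.AbelCoset"
    "HOL-Computational_Algebra.Primes"
    "HOL-Library.Function_Algebras"
begin

section \<open>Right modules over a ring\<close>

text \<open>
  The modules of HOL-Algebra are left modules over a commutative ring, so unital right modules
  over an arbitrary ring are introduced here. As for the record \<open>module\<close> of the library, the
  multiplicative fields of the underlying ring record are junk.
\<close>

record ('a, 'b) rmodule = "'b ring" +
  rsmult :: "['b, 'a] \<Rightarrow> 'b" (infixl \<open>\<odot>\<^sub>r\<index>\<close> 70)

locale right_module = R?: ring R + M?: abelian_group M
  for R :: "('r, 's) ring_scheme" (structure) and M :: "('r, 'm, 't) rmodule_scheme" (structure) +
  assumes rsmult_closed [simp, intro]:
      "\<lbrakk>x \<in> carrier M; a \<in> carrier R\<rbrakk> \<Longrightarrow> x \<odot>\<^sub>r\<^bsub>M\<^esub> a \<in> carrier M"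
    and rsmult_l_distr:
      "\<lbrakk>x \<in> carrier M; y \<in> carrier M; a \<in> carrier R\<rbrakk> \<Longrightarrow>
        (x \<oplus>\<^bsub>M\<^esub> y) \<odot>\<^sub>r\<^bsub>M\<^esub> a = x \<odot>\<^sub>r\<^bsub>M\<^esub> a \<oplus>\<^bsub>M\<^esub> y \<odot>\<^sub>r\<^bsub>M\<^esub> a"
    and rsmult_r_distr:
      "\<lbrakk>x \<in> carrier M; a \<in> carrier R; b \<in> carrier R\<rbrakk> \<Longrightarrow>
        x \<odot>\<^sub>r\<^bsub>M\<^esub> (a \<oplus> b) = x \<odot>\<^sub>r\<^bsub>M\<^esub> a \<oplus>\<^bsub>M\<^esub> x \<odot>\<^sub>r\<^bsub>M\<^esub> b"
    and rsmult_assoc: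
      "\<lbrakk>x \<in> carrier M; a \<in> carrier R; b \<in> carrier R\<rbrakk> \<Longrightarrow>
        x \<odot>\<^sub>r\<^bsub>M\<^esub> (a \<otimes> b) = (x \<odot>\<^sub>r\<^bsub>M\<^esub> a) \<odot>\<^sub>r\<^bsub>M\<^esub> b"
    and rsmult_one [simp]: "x \<in> carrier M \<Longrightarrow> x \<odot>\<^sub>r\<^bsub>M\<^esub> \<one> = x"

definition right_submodule ::
  "('r, 's) ring_scheme \<Rightarrow> ('r, 'm, 't) rmodule_scheme \<Rightarrow> 'm set \<Rightarrow> bool" where
  "right_submodule R M U \<longleftrightarrow>
     additive_subgroup U M \<and> (\<forall>x\<in>U. \<forall>a\<in>carrier R. x \<odot>\<^sub>r\<^bsub>M\<^esub> a \<in> U)"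

definition rmod_hom ::
  "('r, 's) ring_scheme \<Rightarrow> ('r, 'm, 't) rmodule_scheme \<Rightarrow> ('r, 'n, 'u) rmodule_scheme \<Rightarrow> ('m \<Rightarrow> 'n) set"
  where
  "rmod_hom R M N = {f. f \<in> carrier M \<rightarrow> carrier N \<and>
     (\<forall>x\<in>carrier M. \<forall>y\<in>carrier M. f (x \<oplus>\<^bsub>M\<^esub> y) = f x \<oplus>\<^bsub>N\<^esub> f y) \<and>
     (\<forall>x\<in>carrier M. \<forall>a\<in>carrier R. f (x \<odot>\<^sub>r\<^bsub>M\<^esub> a) = f x \<odot>\<^sub>r\<^bsub>N\<^esub> a)}"

lemma rmod_homD:
  assumes "f \<in> rmod_hom R M N" "x \<in> carrier M"
  shows "f x \<in> carrier N"
    and "y \<in> carrier M \<Longrightarrow> f (x \<oplus>\<^bsub>M\<^esub> y) = f x \<oplus>\<^bsub>N\<^esub> f y"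
    and "a \<in> carrier R \<Longrightarrow> f (x \<odot>\<^sub>r\<^bsub>M\<^esub> a) = f x \<odot>\<^sub>r\<^bsub>N\<^esub> a"
  using assms by (auto simp: rmod_hom_def)

text \<open>Internal direct sums: \<open>M = A \<oplus> B\<close> for submodules \<open>A\<close> and \<open>B\<close> of \<open>M\<close>.\<close>

definition rmod_direct_sum ::
  "('r, 's) ring_scheme \<Rightarrow> ('r, 'm, 't) rmodule_scheme \<Rightarrow> 'm set \<Rightarrow> 'm set \<Rightarrow> bool" where
  "rmod_direct_sum R M A B \<longleftrightarrow>
     right_submodule R M A \<and> right_submodule R M B \<and>
     A \<inter> B = {\<zero>\<^bsub>M\<^esub>} \<and> A <+>\<^bsub>M\<^esub> B = carrier M"

text \<open>
  Projectivity is the lifting property along surjective homomorphisms \<open>N \<rightarrow> Q\<close>. A definition cannot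
  quantify over all types, so the carriers of \<open>N\<close> and \<open>Q\<close> are taken from the types
  \<^typ>\<open>'p \<Rightarrow> 'r\<close> and \<^typ>\<open>'p\<close>. This is no restriction: the first type contains the free module on the
  set of elements of \<open>P\<close>, and \<open>projective_rmodule_lift\<close> below derives the
  lifting property for modules over arbitrary types.
\<close>

definition projective_rmodule :: "('r, 's) ring_scheme \<Rightarrow> ('r, 'p, 't) rmodule_scheme \<Rightarrow> bool" where
  "projective_rmodule R P \<longleftrightarrow> right_module R P \<and>
     (\<forall>(N :: ('r, 'p \<Rightarrow> 'r) rmodule) (Q :: ('r, 'p) rmodule) \<pi> f.
        right_module R N \<and> right_module R Q \<and>
        \<pi> \<in> rmod_hom R N Q \<and> \<pi> ` carrier N = carrier Q \<and> f \<in> rmod_hom R P Q \<longrightarrow>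
        (\<exists>h\<in>rmod_hom R P N. \<forall>x\<in>carrier P. \<pi> (h x) = f x))"

text \<open>Superfluous (small) submodules.\<close>

definition superfluous_submodule ::
  "('r, 's) ring_scheme \<Rightarrow> ('r, 'm, 't) rmodule_scheme \<Rightarrow> 'm set \<Rightarrow> bool" where
  "superfluous_submodule R M S \<longleftrightarrow> right_submodule R M S \<and>
     (\<forall>U. right_submodule R M U \<and> S <+>\<^bsub>M\<^esub> U = carrier M \<longrightarrow> U = carrier M)"

definition projective_cover ::
  "('r, 's) ring_scheme \<Rightarrow> ('r, 'p, 't) rmodule_scheme \<Rightarrow> ('r, 'm, 'u) rmodule_scheme \<Rightarrow> bool" where
  "projective_cover R P M \<longleftrightarrow> right_module R M \<and> projective_rmodule R P \<and>
     (\<exists>\<phi>\<in>rmod_hom R P M. \<phi> ` carrier P = carrier M \<and>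
        superfluous_submodule R P {x \<in> carrier P. \<phi> x = \<zero>\<^bsub>M\<^esub>})"


subsection \<open>Independence of projectivity from the chosen types\<close>

lemma additive_subgroupI':
  assumes "abelian_group M" "U \<subseteq> carrier M" "\<zero>\<^bsub>M\<^esub> \<in> U"
    and "\<And>x y. x \<in> U \<Longrightarrow> y \<in> U \<Longrightarrow> x \<oplus>\<^bsub>M\<^esub> y \<in> U"
    and "\<And>x. x \<in> U \<Longrightarrow> \<ominus>\<^bsub>M\<^esub> x \<in> U"
  shows "additive_subgroup U M"
proof -
  interpret abelian_group M by fact
  show ?thesis
    by (intro additive_subgroup.intro add.subgroupI)
      (use assms in \<open>auto simp: a_inv_def\<close>)
qed

lemma right_submodule_right_module:
  assumes "right_module R M" "right_submodule R M U"
  shows "right_module R (M\<lparr>carrier := U\<rparr>)"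
proof -
  interpret right_module R M by fact
  interpret U: additive_subgroup U M using assms(2) by (simp add: right_submodule_def)
  have smul: "x \<odot>\<^sub>r\<^bsub>M\<^esub> a \<in> U" if "x \<in> U" "a \<in> carrier R" for x a
    using assms(2) that by (simp add: right_submodule_def)
  have sub: "x \<in> carrier M" if "x \<in> U" for x
    using that U.a_subset by auto
  have ag: "abelian_group (M\<lparr>carrier := U\<rparr>)"
  proof (rule abelian_groupI)
    fix x assume "x \<in> carrier (M\<lparr>carrier := U\<rparr>)"
    hence x: "x \<in> U" by simp
    have "\<ominus>\<^bsub>M\<^esub> x \<in> U" by (rule U.a_inv_closed[OF x])
    thus "\<exists>y\<in>carrier (M\<lparr>carrier := U\<rparr>). y \<oplus>\<^bsub>M\<lparr>carrier := U\<rparr>\<^esub> x = \<zero>\<^bsub>M\<lparr>carrier := U\<rparr>\<^esub>"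
      using M.l_neg[OF sub[OF x]] by auto
  qed (auto simp: sub M.add.m_ac U.a_closed)
  show ?thesis
    using ag R.ring_axioms
    by (auto intro!: right_module.intro right_module_axioms.intro
        simp: smul sub rsmult_l_distr rsmult_r_distr rsmult_assoc)
qed

lemma additive_map_finsum:
  assumes "abelian_group M" "abelian_group N"
    and f: "f \<in> carrier M \<rightarrow> carrier N"
    and add: "\<And>x y. x \<in> carrier M \<Longrightarrow> y \<in> carrier M \<Longrightarrow> f (x \<oplus>\<^bsub>M\<^esub> y) = f x \<oplus>\<^bsub>N\<^esub> f y"
    and u: "u \<in> A \<rightarrow> carrier M"
  shows "f (finsum M u A) = finsum N (\<lambda>i. f (u i)) A"
proof -
  interpret M: abelian_group M by fact
  interpret N: abelian_group N by fact
  have "f \<zero>\<^bsub>M\<^esub> \<oplus>\<^bsub>N\<^esub> f \<zero>\<^bsub>M\<^esub> = f \<zero>\<^bsub>M\<^esub>" using add[of "\<zero>\<^bsub>M\<^esub>" "\<zero>\<^bsub>M\<^esub>"] by simp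
  moreover have "f \<zero>\<^bsub>M\<^esub> \<in> carrier N" using f by auto
  ultimately have z: "f \<zero>\<^bsub>M\<^esub> = \<zero>\<^bsub>N\<^esub>" using N.add.r_cancel_one by blast
  show ?thesis using u
  proof (induction A rule: infinite_finite_induct)
    case (insert i A)
    hence "u i \<in> carrier M" "u \<in> A \<rightarrow> carrier M" by auto
    moreover from this f have "f (u i) \<in> carrier N" "(\<lambda>i. f (u i)) \<in> A \<rightarrow> carrier N" by auto
    ultimately show ?case using insert by (simp add: add M.finsum_insert N.finsum_insert)
  qed (simp_all add: z)
qed

definition free_rmodule :: "('r, 's) ring_scheme \<Rightarrow> 'x set \<Rightarrow> ('r, 'x \<Rightarrow> 'r) rmodule" where
  "free_rmodule R B =
    \<lparr>carrier = {\<phi>. (\<forall>x. \<phi> x \<in> carrier R) \<and> {x. \<phi> x \<noteq> \<zero>\<^bsub>R\<^esub>} \<subseteq> B \<and> finite {x. \<phi> x \<noteq> \<zero>\<^bsub>R\<^esub>}},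
     monoid.mult = undefined, one = undefined, zero = (\<lambda>_. \<zero>\<^bsub>R\<^esub>), add = (\<lambda>\<phi> \<psi> x. \<phi> x \<oplus>\<^bsub>R\<^esub> \<psi> x),
     rsmult = (\<lambda>\<phi> a x. \<phi> x \<otimes>\<^bsub>R\<^esub> a)\<rparr>"

lemma free_rmodule_right_module:
  fixes R :: "('r, 's) ring_scheme" and B :: "'x set"
  assumes "ring R"
  shows "right_module R (free_rmodule R B)"
proof -
  interpret ring R by fact
  have fin_add: "finite {x. \<phi> x \<oplus>\<^bsub>R\<^esub> \<psi> x \<noteq> \<zero>\<^bsub>R\<^esub>}"
    if "finite {x. \<phi> x \<noteq> \<zero>\<^bsub>R\<^esub>}" "finite {x. \<psi> x \<noteq> \<zero>\<^bsub>R\<^esub>}" for \<phi> \<psi> :: "'x \<Rightarrow> 'r"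
    by (rule finite_subset[OF _ finite_UnI[OF that]]) auto
  have fin_mult: "finite {x. \<phi> x \<otimes>\<^bsub>R\<^esub> a \<noteq> \<zero>\<^bsub>R\<^esub>}"
    if "finite {x. \<phi> x \<noteq> \<zero>\<^bsub>R\<^esub>}" "a \<in> carrier R" for \<phi> :: "'x \<Rightarrow> 'r" and a
    by (rule finite_subset[OF _ that(1)]) (use that(2) in auto)
  have ag: "abelian_group (free_rmodule R B)"
  proof (rule abelian_groupI)
    fix \<phi> :: "'x \<Rightarrow> 'r" assume "\<phi> \<in> carrier (free_rmodule R B)"
    hence *: "\<And>x. \<phi> x \<in> carrier R" "{x. \<phi> x \<noteq> \<zero>\<^bsub>R\<^esub>} \<subseteq> B" "finite {x. \<phi> x \<noteq> \<zero>\<^bsub>R\<^esub>}"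
      by (auto simp: free_rmodule_def)
    have "{x. \<ominus>\<^bsub>R\<^esub> \<phi> x \<noteq> \<zero>\<^bsub>R\<^esub>} \<subseteq> {x. \<phi> x \<noteq> \<zero>\<^bsub>R\<^esub>}" by auto
    hence "(\<lambda>x. \<ominus>\<^bsub>R\<^esub> \<phi> x) \<in> carrier (free_rmodule R B)"
      using * by (auto simp: free_rmodule_def intro: finite_subset)
    moreover have "(\<lambda>x. \<ominus>\<^bsub>R\<^esub> \<phi> x) \<oplus>\<^bsub>free_rmodule R B\<^esub> \<phi> = \<zero>\<^bsub>free_rmodule R B\<^esub>"
      using *(1) by (auto simp: free_rmodule_def l_neg)
    ultimately show "\<exists>\<psi>\<in>carrier (free_rmodule R B). \<psi> \<oplus>\<^bsub>free_rmodule R B\<^esub> \<phi> = \<zero>\<^bsub>free_rmodule R B\<^esub>"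
      by blast
  next
    fix \<phi> \<psi> :: "'x \<Rightarrow> 'r"
    assume "\<phi> \<in> carrier (free_rmodule R B)" "\<psi> \<in> carrier (free_rmodule R B)"
    thus "\<phi> \<oplus>\<^bsub>free_rmodule R B\<^esub> \<psi> \<in> carrier (free_rmodule R B)"
      by (auto simp: free_rmodule_def fin_add subset_iff) (metis l_zero zero_closed)
  qed (auto simp: free_rmodule_def add.m_ac)
  show ?thesis
  proof (intro right_module.intro right_module_axioms.intro ag assms)
    fix \<phi> :: "'x \<Rightarrow> 'r" and a
    assume "\<phi> \<in> carrier (free_rmodule R B)" "a \<in> carrier R"
    thus "\<phi> \<odot>\<^sub>r\<^bsub>free_rmodule R B\<^esub> a \<in> carrier (free_rmodule R B)"
      by (auto simp: free_rmodule_def fin_mult subset_iff) (metis l_null)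
  qed (auto simp: free_rmodule_def l_distr r_distr m_assoc)
qed

definition rmod_lincomb ::
  "('r, 's) ring_scheme \<Rightarrow> ('r, 'n, 't) rmodule_scheme \<Rightarrow> ('x \<Rightarrow> 'n) \<Rightarrow> ('x \<Rightarrow> 'r) \<Rightarrow> 'n" where
  "rmod_lincomb R N n \<phi> = finsum N (\<lambda>x. n x \<odot>\<^sub>r\<^bsub>N\<^esub> \<phi> x) {x. \<phi> x \<noteq> \<zero>\<^bsub>R\<^esub>}"

lemma (in right_module) rsmult_r_zero [simp]:
  assumes "x \<in> carrier M"
  shows "x \<odot>\<^sub>r\<^bsub>M\<^esub> \<zero> = \<zero>\<^bsub>M\<^esub>"
proof -
  have "x \<odot>\<^sub>r\<^bsub>M\<^esub> \<zero> \<oplus>\<^bsub>M\<^esub> x \<odot>\<^sub>r\<^bsub>M\<^esub> \<zero> = x \<odot>\<^sub>r\<^bsub>M\<^esub> \<zero>"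
    using rsmult_r_distr[of x \<zero> \<zero>] assms by simp
  thus ?thesis using assms M.add.r_cancel_one by blast
qed

lemma (in right_module) rmod_lincomb_superset:
  assumes n: "n \<in> B \<rightarrow> carrier M" and \<phi>: "\<And>x. \<phi> x \<in> carrier R"
    and A: "finite A" "{x. \<phi> x \<noteq> \<zero>} \<subseteq> A" "A \<subseteq> B"
  shows "rmod_lincomb R M n \<phi> = finsum M (\<lambda>x. n x \<odot>\<^sub>r\<^bsub>M\<^esub> \<phi> x) A"
  unfolding rmod_lincomb_def
  by (rule M.add.finprod_mono_neutral_cong_left) (use assms in \<open>auto simp: subset_iff Pi_iff\<close>)

lemma rmod_lincomb_hom:
  assumes "right_module R N" and n: "n \<in> B \<rightarrow> carrier N"
  shows "rmod_lincomb R N n \<in> rmod_hom R (free_rmodule R B) N"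
proof -
  interpret right_module R N by fact
  let ?s = "\<lambda>\<phi>. {x. \<phi> x \<noteq> \<zero>\<^bsub>R\<^esub>}"
  have F: "(\<forall>x. \<phi> x \<in> carrier R) \<and> ?s \<phi> \<subseteq> B \<and> finite (?s \<phi>)"
    if "\<phi> \<in> carrier (free_rmodule R B)" for \<phi>
    using that by (auto simp: free_rmodule_def)
  show ?thesis unfolding rmod_hom_def
  proof (intro CollectI conjI ballI funcsetI)
    fix \<phi> assume "\<phi> \<in> carrier (free_rmodule R B)"
    with F[of \<phi>] n show "rmod_lincomb R N n \<phi> \<in> carrier N"
      unfolding rmod_lincomb_def by (intro M.finsum_closed) auto
  next
    fix \<phi> \<psi> assume a: "\<phi> \<in> carrier (free_rmodule R B)" "\<psi> \<in> carrier (free_rmodule R B)"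
    let ?A = "?s \<phi> \<union> ?s \<psi>"
    have A: "finite ?A" "?A \<subseteq> B" using a[THEN F] by auto
    have c: "\<And>x. \<phi> x \<in> carrier R" "\<And>x. \<psi> x \<in> carrier R" using a[THEN F] by auto
    have nA: "n x \<in> carrier N" if "x \<in> ?A" for x using n A(2) that by blast
    have "rmod_lincomb R N n (\<phi> \<oplus>\<^bsub>free_rmodule R B\<^esub> \<psi>)
        = finsum N (\<lambda>x. n x \<odot>\<^sub>r\<^bsub>N\<^esub> (\<phi> x \<oplus>\<^bsub>R\<^esub> \<psi> x)) ?A"
      unfolding free_rmodule_def
      by (simp, rule rmod_lincomb_superset[OF n]) (use A c in auto)
    also have "\<dots> = finsum N (\<lambda>x. n x \<odot>\<^sub>r\<^bsub>N\<^esub> \<phi> x \<oplus>\<^bsub>N\<^esub> n x \<odot>\<^sub>r\<^bsub>N\<^esub> \<psi> x) ?A"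
      by (rule M.finsum_cong') (auto simp: c nA[simplified] rsmult_r_distr)
    also have "\<dots> = finsum N (\<lambda>x. n x \<odot>\<^sub>r\<^bsub>N\<^esub> \<phi> x) ?A \<oplus>\<^bsub>N\<^esub> finsum N (\<lambda>x. n x \<odot>\<^sub>r\<^bsub>N\<^esub> \<psi> x) ?A"
      by (rule M.finsum_addf) (auto simp: c nA[simplified])
    also have "\<dots> = rmod_lincomb R N n \<phi> \<oplus>\<^bsub>N\<^esub> rmod_lincomb R N n \<psi>"
      using rmod_lincomb_superset[OF n c(1), of ?A] rmod_lincomb_superset[OF n c(2), of ?A] A
      by simp
    finally show "rmod_lincomb R N n (\<phi> \<oplus>\<^bsub>free_rmodule R B\<^esub> \<psi>)
      = rmod_lincomb R N n \<phi> \<oplus>\<^bsub>N\<^esub> rmod_lincomb R N n \<psi>" .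
  next
    fix \<phi> a assume a: "\<phi> \<in> carrier (free_rmodule R B)" "a \<in> carrier R"
    have c: "\<And>x. \<phi> x \<in> carrier R" and A: "finite (?s \<phi>)" "?s \<phi> \<subseteq> B" using F[OF a(1)] by auto
    have nA: "n x \<in> carrier N" if "x \<in> ?s \<phi>" for x using n A(2) that by blast
    have "rmod_lincomb R N n (\<phi> \<odot>\<^sub>r\<^bsub>free_rmodule R B\<^esub> a)
        = finsum N (\<lambda>x. n x \<odot>\<^sub>r\<^bsub>N\<^esub> (\<phi> x \<otimes>\<^bsub>R\<^esub> a)) (?s \<phi>)"
      unfolding free_rmodule_def
      by (simp, rule rmod_lincomb_superset[OF n]) (use A c a in auto)
    also have "\<dots> = finsum N (\<lambda>x. (n x \<odot>\<^sub>r\<^bsub>N\<^esub> \<phi> x) \<odot>\<^sub>r\<^bsub>N\<^esub> a) (?s \<phi>)"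
      by (rule M.finsum_cong') (auto simp: c a nA[simplified] rsmult_assoc)
    also have "\<dots> = rmod_lincomb R N n \<phi> \<odot>\<^sub>r\<^bsub>N\<^esub> a"
      unfolding rmod_lincomb_def
      by (rule additive_map_finsum[symmetric, OF M.abelian_group_axioms M.abelian_group_axioms])
        (auto simp: a c nA[simplified] rsmult_l_distr)
    finally show "rmod_lincomb R N n (\<phi> \<odot>\<^sub>r\<^bsub>free_rmodule R B\<^esub> a) = rmod_lincomb R N n \<phi> \<odot>\<^sub>r\<^bsub>N\<^esub> a" .
  qed
qed

lemma rmod_hom_truncate:
  "rmod_hom R (rmodule.truncate M) N = rmod_hom R M N"
  "rmod_hom R M (rmodule.truncate N) = rmod_hom R M N"
  by (simp_all add: rmod_hom_def rmodule.truncate_def)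

lemma right_module_truncate: "right_module R M \<Longrightarrow> right_module R (rmodule.truncate M)"
proof -
  assume "right_module R M"
  then interpret right_module R M .
  have "abelian_group (rmodule.truncate M)"
    by (rule abelian_groupI)
      (auto simp: rmodule.truncate_def M.add.m_ac intro: bexI[of _ "\<ominus>\<^bsub>M\<^esub> _"] M.l_neg)
  thus ?thesis
    by (intro right_module.intro right_module_axioms.intro R.ring_axioms)
      (auto simp: rmodule.truncate_def rsmult_l_distr rsmult_r_distr rsmult_assoc)
qed

theorem projective_rmodule_lift:
  fixes P :: "('r, 'p, 't) rmodule_scheme"
    and N :: "('r, 'n, 'u) rmodule_scheme" and Q :: "('r, 'q, 'v) rmodule_scheme"
  assumes P: "projective_rmodule R P" and N: "right_module R N" and Q: "right_module R Q"
    and \<pi>: "\<pi> \<in> rmod_hom R N Q" "\<pi> ` carrier N = carrier Q" and f: "f \<in> rmod_hom R P Q"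
  shows "\<exists>h\<in>rmod_hom R P N. \<forall>x\<in>carrier P. \<pi> (h x) = f x"
proof -
  interpret P: right_module R P using P by (simp add: projective_rmodule_def)
  interpret N: right_module R N by fact
  interpret Q: right_module R Q by fact
  let ?F = "free_rmodule R (carrier P)"
  let ?\<epsilon> = "rmod_lincomb R P (\<lambda>x. x)"
  have \<epsilon>: "?\<epsilon> \<in> rmod_hom R ?F P"
    by (rule rmod_lincomb_hom) (auto intro: P.right_module_axioms)
  have "x \<in> ?\<epsilon> ` carrier ?F" if x: "x \<in> carrier P" for x
  proof -
    let ?\<delta> = "\<lambda>y. if y = x then \<one>\<^bsub>R\<^esub> else \<zero>\<^bsub>R\<^esub>"
    have "finite {y. ?\<delta> y \<noteq> \<zero>\<^bsub>R\<^esub>}" by (rule finite_subset[of _ "{x}"]) auto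
    hence "?\<delta> \<in> carrier ?F" using x by (auto simp: free_rmodule_def)
    moreover have "?\<epsilon> ?\<delta> = finsum P (\<lambda>y. y \<odot>\<^sub>r\<^bsub>P\<^esub> ?\<delta> y) {x}"
      by (rule P.rmod_lincomb_superset[where B = "carrier P"]) (use x in auto)
    hence "?\<epsilon> ?\<delta> = x" using x by (simp add: P.M.finsum_insert)
    ultimately show ?thesis by (metis image_eqI)
  qed
  hence \<epsilon>_surj: "?\<epsilon> ` carrier ?F = carrier P"
    using \<epsilon> by (auto simp: rmod_hom_def)
  have id: "(\<lambda>x. x) \<in> rmod_hom R P (rmodule.truncate P)"
    unfolding rmod_hom_truncate by (simp add: rmod_hom_def)
  have \<epsilon>': "?\<epsilon> \<in> rmod_hom R ?F (rmodule.truncate P)"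
    unfolding rmod_hom_truncate by (rule \<epsilon>)
  have surj': "?\<epsilon> ` carrier ?F = carrier (rmodule.truncate P)"
    using \<epsilon>_surj by (simp add: rmodule.truncate_def)
  have "\<exists>h\<in>rmod_hom R P ?F. \<forall>x\<in>carrier P. ?\<epsilon> (h x) = x"
    by (rule P[unfolded projective_rmodule_def, THEN conjunct2, rule_format,
          where Q = "rmodule.truncate P"])
      (intro conjI free_rmodule_right_module right_module_truncate P.R.ring_axioms
        P.right_module_axioms \<epsilon>' surj' id)
  then obtain s where s: "s \<in> rmod_hom R P ?F" "\<And>x. x \<in> carrier P \<Longrightarrow> ?\<epsilon> (s x) = x"
    by blast
  have "\<exists>y\<in>carrier N. \<pi> y = f x" if "x \<in> carrier P" for x
  proof -
    have "f x \<in> \<pi> ` carrier N" unfolding \<pi>(2) by (rule rmod_homD(1)[OF f that])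
    then obtain y where "f x = \<pi> y" "y \<in> carrier N" by (rule imageE)
    thus ?thesis by (intro bexI[of _ y]) simp_all
  qed
  hence "\<exists>n. \<forall>x\<in>carrier P. n x \<in> carrier N \<and> \<pi> (n x) = f x"
    by (intro bchoice ballI) (simp add: Bex_def)
  then obtain n where "\<forall>x\<in>carrier P. n x \<in> carrier N \<and> \<pi> (n x) = f x" ..
  hence n: "n x \<in> carrier N" "\<pi> (n x) = f x" if "x \<in> carrier P" for x
    using that by simp_all
  let ?\<psi> = "rmod_lincomb R N n"
  have \<psi>: "?\<psi> \<in> rmod_hom R ?F N"
    by (rule rmod_lincomb_hom[OF N]) (simp add: n)
  have eq: "\<pi> (?\<psi> \<phi>) = f (?\<epsilon> \<phi>)" if "\<phi> \<in> carrier ?F" for \<phi>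
  proof -
    have c: "\<phi> x \<in> carrier R" and A: "{x. \<phi> x \<noteq> \<zero>\<^bsub>R\<^esub>} \<subseteq> carrier P" for x
      using that by (auto simp: free_rmodule_def)
    have nA: "n x \<in> carrier N" "\<pi> (n x) = f x" "x \<in> carrier P" if "x \<in> {x. \<phi> x \<noteq> \<zero>\<^bsub>R\<^esub>}" for x
      using n A that by blast+
    have "\<pi> (?\<psi> \<phi>) = finsum Q (\<lambda>x. \<pi> (n x \<odot>\<^sub>r\<^bsub>N\<^esub> \<phi> x)) {x. \<phi> x \<noteq> \<zero>\<^bsub>R\<^esub>}"
      unfolding rmod_lincomb_def
      by (rule additive_map_finsum[where f = \<pi>, OF N.M.abelian_group_axioms Q.M.abelian_group_axioms])
        (simp_all add: c nA[simplified] rmod_homD[OF \<pi>(1)])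
    also have "\<dots> = finsum Q (\<lambda>x. f (x \<odot>\<^sub>r\<^bsub>P\<^esub> \<phi> x)) {x. \<phi> x \<noteq> \<zero>\<^bsub>R\<^esub>}"
    proof (rule Q.M.finsum_cong'[OF refl])
      show "(\<lambda>x. f (x \<odot>\<^sub>r\<^bsub>P\<^esub> \<phi> x)) \<in> {x. \<phi> x \<noteq> \<zero>\<^bsub>R\<^esub>} \<rightarrow> carrier Q"
        by (intro funcsetI rmod_homD(1)[OF f] P.rsmult_closed nA c)
      show "\<pi> (n x \<odot>\<^sub>r\<^bsub>N\<^esub> \<phi> x) = f (x \<odot>\<^sub>r\<^bsub>P\<^esub> \<phi> x)" if "x \<in> {x. \<phi> x \<noteq> \<zero>\<^bsub>R\<^esub>}" for x
        using rmod_homD(3)[OF \<pi>(1) nA(1)[OF that] c] rmod_homD(3)[OF f nA(3)[OF that] c]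
          nA(2)[OF that] by simp
    qed
    also have "\<dots> = f (?\<epsilon> \<phi>)"
      unfolding rmod_lincomb_def
      by (rule additive_map_finsum[symmetric, where f = f,
            OF P.M.abelian_group_axioms Q.M.abelian_group_axioms])
        (simp_all add: c nA[simplified] rmod_homD[OF f])
    finally show ?thesis .
  qed
  have "(\<lambda>x. ?\<psi> (s x)) \<in> rmod_hom R P N"
    unfolding rmod_hom_def[of R P N]
    by (simp add: Pi_iff rmod_homD[OF s(1)] rmod_homD[OF \<psi>])
  moreover have "\<pi> (?\<psi> (s x)) = f x" if "x \<in> carrier P" for x
    using eq[OF rmod_homD(1)[OF s(1) that]] s(2)[OF that] by simp
  ultimately show ?thesis by (intro bexI[of _ "\<lambda>x. ?\<psi> (s x)"] ballI)
qed


section \<open>Group algebras and group codes\<close>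

text \<open>
  An element \<open>\<Sum>g. a\<^sub>g g\<close> of \<open>KG\<close> is the function \<open>g \<mapsto> a\<^sub>g\<close>, extended by \<open>0\<close> outside the carrier of
  \<open>G\<close>; the multiplication is convolution.
\<close>

definition group_algebra :: "('g, 's) monoid_scheme \<Rightarrow> ('g \<Rightarrow> 'k::field) ring" where
  "group_algebra G =
    \<lparr>carrier = {a. \<forall>g. g \<notin> carrier G \<longrightarrow> a g = 0},
     monoid.mult = (\<lambda>a b g. if g \<in> carrier G then \<Sum>h\<in>carrier G. a h * b (inv\<^bsub>G\<^esub> h \<otimes>\<^bsub>G\<^esub> g) else 0),
     one = (\<lambda>g. if g = \<one>\<^bsub>G\<^esub> then 1 else 0),
     zero = (\<lambda>_. 0),
     add = (\<lambda>a b g. a g + b g)\<rparr>"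

definition regular_rmodule :: "('r, 's) ring_scheme \<Rightarrow> ('r, 'r) rmodule" where
  "regular_rmodule R =
    \<lparr>carrier = carrier R, monoid.mult = monoid.mult R, one = one R, zero = zero R, add = add R, rsmult = monoid.mult R\<rparr>"

text \<open>\<open>K\<^sub>G\<close>: every group element acts as the identity.\<close>

definition trivial_rmodule :: "('g, 's) monoid_scheme \<Rightarrow> ('g \<Rightarrow> 'k::field, 'k) rmodule" where
  "trivial_rmodule G =
    \<lparr>carrier = UNIV, monoid.mult = (*), one = 1, zero = 0, add = (+),
     rsmult = (\<lambda>c a. c * (\<Sum>g\<in>carrier G. a g))\<rparr>"

definition group_code :: "('g, 's) monoid_scheme \<Rightarrow> ('g \<Rightarrow> 'k::field) set \<Rightarrow> bool" where
  "group_code G C \<longleftrightarrow> right_submodule (group_algebra G) (regular_rmodule (group_algebra G)) C"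

definition code_rmodule ::
  "('g, 's) monoid_scheme \<Rightarrow> ('g \<Rightarrow> 'k::field) set \<Rightarrow> ('g \<Rightarrow> 'k, 'g \<Rightarrow> 'k) rmodule" where
  "code_rmodule G C = regular_rmodule (group_algebra G)\<lparr>carrier := C\<rparr>"

definition code_inner :: "('g, 's) monoid_scheme \<Rightarrow> ('g \<Rightarrow> 'k::field) \<Rightarrow> ('g \<Rightarrow> 'k) \<Rightarrow> 'k" where
  "code_inner G a b = (\<Sum>g\<in>carrier G. a g * b g)"

definition dual_code :: "('g, 's) monoid_scheme \<Rightarrow> ('g \<Rightarrow> 'k::field) set \<Rightarrow> ('g \<Rightarrow> 'k) set" where
  "dual_code G C = {v \<in> carrier (group_algebra G). \<forall>c\<in>C. code_inner G v c = 0}"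

definition kscale :: "'k::field \<Rightarrow> ('g \<Rightarrow> 'k) \<Rightarrow> 'g \<Rightarrow> 'k" where
  "kscale c a = (\<lambda>g. c * a g)"

global_interpretation kvec: vector_space "kscale :: 'k::field \<Rightarrow> ('g \<Rightarrow> 'k) \<Rightarrow> 'g \<Rightarrow> 'k"
  by unfold_locales (auto simp: kscale_def algebra_simps)

text \<open>The componentwise product of \<open>c\<close> and \<open>c'\<close> is \<^term>\<open>c * c'\<close> in the pointwise structure on functions.\<close>

definition schur_square :: "('g \<Rightarrow> 'k::field) set \<Rightarrow> ('g \<Rightarrow> 'k) set" where
  "schur_square C = kvec.span {c * c' | c c'. c \<in> C \<and> c' \<in> C}"


subsection \<open>Well-definedness\<close>

lemma (in group) sum_translate:
  fixes f :: "'a \<Rightarrow> 'k::comm_monoid_add"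
  assumes "k \<in> carrier G"
  shows "(\<Sum>h\<in>carrier G. f (k \<otimes> h)) = (\<Sum>h\<in>carrier G. f h)"
  by (rule sum.reindex_bij_witness[where i = "\<lambda>h. inv k \<otimes> h" and j = "\<lambda>h. k \<otimes> h"])
    (use assms in \<open>auto simp: m_assoc[symmetric]\<close>)

lemma group_algebra_ring:
  fixes G :: "('g, 's) monoid_scheme" (structure)
  assumes "group G" "finite (carrier G)"
  shows "ring (group_algebra G :: ('g \<Rightarrow> 'k::field) ring)"
proof -
  interpret group G by fact
  let ?A = "group_algebra G :: ('g \<Rightarrow> 'k::field) ring"
  have ag: "abelian_group ?A"
  proof (rule abelian_groupI)
    fix a assume "a \<in> carrier ?A"
    thus "\<exists>b\<in>carrier ?A. b \<oplus>\<^bsub>?A\<^esub> a = \<zero>\<^bsub>?A\<^esub>"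
      by (intro bexI[of _ "\<lambda>g. - a g"]) (auto simp: group_algebra_def)
  qed (auto simp: group_algebra_def algebra_simps)
  have ind: "inv h \<otimes> g = \<one> \<longleftrightarrow> g = h" if "h \<in> carrier G" "g \<in> carrier G" for g h
    using that by (metis inv_closed inv_equality inv_inv l_inv)
  have "monoid ?A"
  proof (rule monoidI)
    fix a b c assume abc: "a \<in> carrier ?A" "b \<in> carrier ?A" "c \<in> carrier ?A"
    show "a \<otimes>\<^bsub>?A\<^esub> b \<otimes>\<^bsub>?A\<^esub> c = a \<otimes>\<^bsub>?A\<^esub> (b \<otimes>\<^bsub>?A\<^esub> c)"
    proof
      fix g
      show "(a \<otimes>\<^bsub>?A\<^esub> b \<otimes>\<^bsub>?A\<^esub> c) g = (a \<otimes>\<^bsub>?A\<^esub> (b \<otimes>\<^bsub>?A\<^esub> c)) g"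
      proof (cases "g \<in> carrier G")
        case g: True
        have "(a \<otimes>\<^bsub>?A\<^esub> b \<otimes>\<^bsub>?A\<^esub> c) g
            = (\<Sum>h\<in>carrier G. \<Sum>k\<in>carrier G. a k * b (inv k \<otimes> h) * c (inv h \<otimes> g))"
          using g by (simp add: group_algebra_def sum_distrib_right)
        also have "\<dots> = (\<Sum>k\<in>carrier G. \<Sum>h\<in>carrier G. a k * b (inv k \<otimes> h) * c (inv h \<otimes> g))"
          by (rule sum.swap)
        also have "\<dots> = (\<Sum>k\<in>carrier G. \<Sum>h\<in>carrier G. a k * (b h * c (inv h \<otimes> (inv k \<otimes> g))))"
        proof (rule sum.cong[OF refl])
          fix k assume k: "k \<in> carrier G"
          have "(\<Sum>h\<in>carrier G. a k * b (inv k \<otimes> h) * c (inv h \<otimes> g))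
              = (\<Sum>h\<in>carrier G. a k * b (inv k \<otimes> (k \<otimes> h)) * c (inv (k \<otimes> h) \<otimes> g))"
            by (rule sum_translate[OF k, symmetric])
          also have "\<dots> = (\<Sum>h\<in>carrier G. a k * (b h * c (inv h \<otimes> (inv k \<otimes> g))))"
          proof (rule sum.cong[OF refl])
            fix h assume h: "h \<in> carrier G"
            have "inv k \<otimes> (k \<otimes> h) = h" "inv (k \<otimes> h) \<otimes> g = inv h \<otimes> (inv k \<otimes> g)"
              using h k g by (simp_all add: inv_mult_group m_assoc inv_solve_left')
            thus "a k * b (inv k \<otimes> (k \<otimes> h)) * c (inv (k \<otimes> h) \<otimes> g)
              = a k * (b h * c (inv h \<otimes> (inv k \<otimes> g)))"
              by (simp add: mult.assoc)
          qed
          finally show "(\<Sum>h\<in>carrier G. a k * b (inv k \<otimes> h) * c (inv h \<otimes> g))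
            = (\<Sum>h\<in>carrier G. a k * (b h * c (inv h \<otimes> (inv k \<otimes> g))))" .
        qed
        also have "\<dots> = (a \<otimes>\<^bsub>?A\<^esub> (b \<otimes>\<^bsub>?A\<^esub> c)) g"
          using g by (simp add: group_algebra_def sum_distrib_left)
        finally show ?thesis .
      qed (simp add: group_algebra_def)
    qed
  next
    fix a assume a: "a \<in> carrier ?A"
    show "\<one>\<^bsub>?A\<^esub> \<otimes>\<^bsub>?A\<^esub> a = a"
    proof
      fix g show "(\<one>\<^bsub>?A\<^esub> \<otimes>\<^bsub>?A\<^esub> a) g = a g"
      proof (cases "g \<in> carrier G")
        case g: True
        hence "(\<one>\<^bsub>?A\<^esub> \<otimes>\<^bsub>?A\<^esub> a) g
            = (\<Sum>h\<in>carrier G. (if h = \<one> then 1 else 0) * a (inv h \<otimes> g))"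
          by (simp add: group_algebra_def)
        also have "\<dots> = (\<Sum>h\<in>carrier G. if h = \<one> then a g else 0)"
          by (rule sum.cong) (use g in auto)
        finally have "(\<one>\<^bsub>?A\<^esub> \<otimes>\<^bsub>?A\<^esub> a) g = (\<Sum>h\<in>carrier G. if h = \<one> then a g else 0)" .
        thus ?thesis using assms(2) by (simp add: sum.delta)
      qed (use a in \<open>simp add: group_algebra_def\<close>)
    qed
    show "a \<otimes>\<^bsub>?A\<^esub> \<one>\<^bsub>?A\<^esub> = a"
    proof
      fix g show "(a \<otimes>\<^bsub>?A\<^esub> \<one>\<^bsub>?A\<^esub>) g = a g"
      proof (cases "g \<in> carrier G")
        case g: True
        hence "(a \<otimes>\<^bsub>?A\<^esub> \<one>\<^bsub>?A\<^esub>) g = (\<Sum>h\<in>carrier G. if g = h then a h else 0)"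
          by (auto simp: group_algebra_def ind intro!: sum.cong)
        thus ?thesis using g assms(2) by (simp add: sum.delta')
      qed (use a in \<open>simp add: group_algebra_def\<close>)
    qed
  qed (auto simp: group_algebra_def)
  thus ?thesis
    by (intro ringI ag)
      (auto simp: group_algebra_def fun_eq_iff algebra_simps sum.distrib)
qed

lemma regular_rmodule_right_module:
  assumes "ring R"
  shows "right_module R (regular_rmodule R)"
proof -
  interpret ring R by fact
  have "abelian_group (regular_rmodule R)"
    by (rule abelian_groupI)
      (auto simp: regular_rmodule_def a_ac intro: bexI[of _ "\<ominus>\<^bsub>R\<^esub> _"] l_neg)
  thus ?thesis
    by (intro right_module.intro right_module_axioms.intro ring_axioms)
      (auto simp: regular_rmodule_def l_distr r_distr m_assoc)
qed

lemma trivial_rmodule_right_module: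
  fixes G :: "('g, 's) monoid_scheme" (structure)
  assumes "group G" "finite (carrier G)"
  shows "right_module (group_algebra G) (trivial_rmodule G :: ('g \<Rightarrow> 'k::field, 'k) rmodule)"
proof -
  interpret group G by fact
  have "abelian_group (trivial_rmodule G :: ('g \<Rightarrow> 'k, 'k) rmodule)"
    by (rule abelian_groupI)
      (auto simp: trivial_rmodule_def algebra_simps intro: exI[of _ "- _"])
  moreover have "(\<Sum>g\<in>carrier G. (a \<otimes>\<^bsub>group_algebra G\<^esub> b) g)
      = (\<Sum>g\<in>carrier G. a g) * (\<Sum>g\<in>carrier G. b g)" for a b :: "'g \<Rightarrow> 'k"
  proof -
    have "(\<Sum>g\<in>carrier G. (a \<otimes>\<^bsub>group_algebra G\<^esub> b) g)
        = (\<Sum>g\<in>carrier G. \<Sum>h\<in>carrier G. a h * b (inv h \<otimes> g))"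
      by (simp add: group_algebra_def)
    also have "\<dots> = (\<Sum>h\<in>carrier G. a h * (\<Sum>g\<in>carrier G. b (inv h \<otimes> g)))"
      by (subst sum.swap) (simp add: sum_distrib_left)
    also have "\<dots> = (\<Sum>h\<in>carrier G. a h * (\<Sum>g\<in>carrier G. b g))"
      by (rule sum.cong) (simp_all add: sum_translate)
    finally show ?thesis by (simp add: sum_distrib_right)
  qed
  moreover have "(\<Sum>g\<in>carrier G. \<one>\<^bsub>group_algebra G\<^esub> g) = (1::'k)"
    using assms(2) by (simp add: group_algebra_def)
  ultimately show ?thesis
    by (intro right_module.intro right_module_axioms.intro group_algebra_ring assms)
      (auto simp: trivial_rmodule_def algebra_simps, auto simp: group_algebra_def sum.distrib algebra_simps)
qed

lemma code_rmodule_right_module: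
  assumes "group G" "finite (carrier G)" "group_code G C"
  shows "right_module (group_algebra G) (code_rmodule G C)"
  using assms unfolding code_rmodule_def group_code_def
  by (intro right_submodule_right_module regular_rmodule_right_module group_algebra_ring)

lemma group_codeI:
  fixes G :: "('g, 's) monoid_scheme" (structure) and C :: "('g \<Rightarrow> 'k::field) set"
  assumes "group G" "finite (carrier G)"
    and sub: "C \<subseteq> carrier (group_algebra G)" and C: "kvec.subspace C"
    and act: "\<And>a k. a \<in> C \<Longrightarrow> k \<in> carrier G \<Longrightarrow>
                (\<lambda>g. if g \<in> carrier G then a (g \<otimes>\<^bsub>G\<^esub> k) else 0) \<in> C"
  shows "group_code G C"
proof -
  interpret group G by fact
  let ?A = "group_algebra G :: ('g \<Rightarrow> 'k) ring"
  interpret A: ring ?A by (rule group_algebra_ring) fact+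
  interpret r: right_module ?A "regular_rmodule ?A"
    by (rule regular_rmodule_right_module) (rule A.ring_axioms)
  have neg: "\<ominus>\<^bsub>regular_rmodule ?A\<^esub> a = - a" if "a \<in> carrier ?A" for a
    by (rule r.M.minus_equality) (use that in \<open>auto simp: regular_rmodule_def group_algebra_def\<close>)
  have "additive_subgroup C (regular_rmodule ?A)"
  proof (rule additive_subgroupI'[OF r.M.abelian_group_axioms])
    show "C \<subseteq> carrier (regular_rmodule ?A)" using sub by (simp add: regular_rmodule_def)
    show "\<zero>\<^bsub>regular_rmodule ?A\<^esub> \<in> C"
      using kvec.subspace_0[OF C] by (simp add: regular_rmodule_def group_algebra_def zero_fun_def)
    show "a \<oplus>\<^bsub>regular_rmodule ?A\<^esub> b \<in> C" if "a \<in> C" "b \<in> C" for a b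
      using kvec.subspace_add[OF C that]
      by (simp add: regular_rmodule_def group_algebra_def plus_fun_def)
    show "\<ominus>\<^bsub>regular_rmodule ?A\<^esub> a \<in> C" if "a \<in> C" for a
      using kvec.subspace_neg[OF C that] neg sub that by auto
  qed
  moreover have "a \<otimes>\<^bsub>?A\<^esub> b \<in> C" if "a \<in> C" "b \<in> carrier ?A" for a b
  proof -
    define T where "T k = (\<lambda>g. if g \<in> carrier G then a (g \<otimes> inv k) else 0)" for k
    have "a \<otimes>\<^bsub>?A\<^esub> b = (\<Sum>k\<in>carrier G. kscale (b k) (T k))"
    proof
      fix g
      have sum_app: "(\<Sum>k\<in>S. f k) g = (\<Sum>k\<in>S. f k g)" for S and f :: "'g \<Rightarrow> 'g \<Rightarrow> 'k"
        by (induction S rule: infinite_finite_induct) auto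
      show "(a \<otimes>\<^bsub>?A\<^esub> b) g = (\<Sum>k\<in>carrier G. kscale (b k) (T k)) g"
      proof (cases "g \<in> carrier G")
        case g: True
        have "(a \<otimes>\<^bsub>?A\<^esub> b) g = (\<Sum>h\<in>carrier G. a h * b (inv h \<otimes> g))"
          using g by (simp add: group_algebra_def)
        also have "\<dots> = (\<Sum>k\<in>carrier G. b k * a (g \<otimes> inv k))"
          by (rule sum.reindex_bij_witness[where i = "\<lambda>k. g \<otimes> inv k" and j = "\<lambda>h. inv h \<otimes> g"])
            (use g in \<open>auto simp: inv_mult_group m_assoc m_assoc[symmetric, of g "inv g"]\<close>)
        finally show ?thesis using g by (simp add: sum_app kscale_def T_def)
      qed (simp add: group_algebra_def sum_app kscale_def T_def)
    qed
    moreover have "T k \<in> C" if "k \<in> carrier G" for k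
      unfolding T_def using act \<open>a \<in> C\<close> that by simp
    ultimately show ?thesis
      by (auto intro!: kvec.subspace_sum[OF C] kvec.subspace_scale[OF C])
  qed
  ultimately show ?thesis
    by (simp add: group_code_def right_submodule_def) (simp add: regular_rmodule_def)
qed

lemma group_code_translate:
  fixes G :: "('g, 's) monoid_scheme" (structure) and C :: "('g \<Rightarrow> 'k::field) set"
  assumes "group G" "finite (carrier G)" "group_code G C" "a \<in> C" "k \<in> carrier G"
  shows "(\<lambda>g. if g \<in> carrier G then a (g \<otimes>\<^bsub>G\<^esub> k) else 0) \<in> C"
proof -
  interpret group G by fact
  let ?A = "group_algebra G :: ('g \<Rightarrow> 'k) ring"
  let ?u = "\<lambda>g. if g = inv k then 1 else 0 :: 'k"
  have "?u \<in> carrier ?A" using assms(5) by (auto simp: group_algebra_def)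
  hence "a \<otimes>\<^bsub>?A\<^esub> ?u \<in> C"
    using assms(3,4) by (simp add: group_code_def right_submodule_def regular_rmodule_def)
  moreover have "a \<otimes>\<^bsub>?A\<^esub> ?u = (\<lambda>g. if g \<in> carrier G then a (g \<otimes> k) else 0)"
  proof
    fix g show "(a \<otimes>\<^bsub>?A\<^esub> ?u) g = (if g \<in> carrier G then a (g \<otimes> k) else 0)"
    proof (cases "g \<in> carrier G")
      case g: True
      have "inv h \<otimes> g = inv k \<longleftrightarrow> h = g \<otimes> k" if "h \<in> carrier G" for h
        using that g assms(5)
        by (metis inv_closed inv_inv inv_solve_left inv_solve_right m_closed)
      hence "(a \<otimes>\<^bsub>?A\<^esub> ?u) g = (\<Sum>h\<in>carrier G. if h = g \<otimes> k then a h else 0)"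
        using g by (auto simp: group_algebra_def intro!: sum.cong)
      thus ?thesis using g assms(2,5) by (simp add: sum.delta)
    qed (simp add: group_algebra_def)
  qed
  ultimately show ?thesis by simp
qed

lemma group_code_schur_square:
  fixes C :: "('g \<Rightarrow> 'k::field) set"
  assumes "group G" "finite (carrier G)" "group_code G C"
  shows "group_code G (schur_square C)"
proof (rule group_codeI[OF assms(1,2)])
  let ?S = "{c * c' | c c'. c \<in> C \<and> c' \<in> C}"
  interpret additive_subgroup C "regular_rmodule (group_algebra G)"
    using assms(3) by (simp add: group_code_def right_submodule_def)
  have C: "C \<subseteq> carrier (group_algebra G)" using a_subset by (simp add: regular_rmodule_def)
  have "kvec.subspace (carrier (group_algebra G) :: ('g \<Rightarrow> 'k) set)"
    by (auto simp: kvec.subspace_def group_algebra_def kscale_def)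
  thus "schur_square C \<subseteq> carrier (group_algebra G)"
    unfolding schur_square_def
    by (intro kvec.span_minimal) (use C in \<open>force simp: group_algebra_def\<close>)+
  show "kvec.subspace (schur_square C)" by (simp add: schur_square_def)
  fix a k assume a: "a \<in> schur_square C" and k: "k \<in> carrier G"
  let ?T = "\<lambda>a::'g \<Rightarrow> 'k. (\<lambda>g. if g \<in> carrier G then a (g \<otimes>\<^bsub>G\<^esub> k) else 0)"
  have "kvec.subspace {a. ?T a \<in> schur_square C}"
  proof (rule kvec.subspaceI)
    have S: "kvec.subspace (schur_square C)" by (simp add: schur_square_def)
    have "?T 0 = 0" by auto
    thus "0 \<in> {a. ?T a \<in> schur_square C}" using kvec.subspace_0[OF S] by simp
    fix a b :: "'g \<Rightarrow> 'k"
    have "?T (a + b) = ?T a + ?T b" by auto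
    thus "a + b \<in> {a. ?T a \<in> schur_square C}"
      if "a \<in> {a. ?T a \<in> schur_square C}" "b \<in> {a. ?T a \<in> schur_square C}"
      using kvec.subspace_add[OF S] that by simp
    fix c
    have "?T (kscale c a) = kscale c (?T a)" by (auto simp: kscale_def)
    thus "kscale c a \<in> {a. ?T a \<in> schur_square C}" if "a \<in> {a. ?T a \<in> schur_square C}"
      using kvec.subspace_scale[OF S] that by simp
  qed
  moreover have "?S \<subseteq> {a. ?T a \<in> schur_square C}"
  proof clarify
    fix c c' assume c: "c \<in> C" "c' \<in> C"
    have "?T (c * c') = ?T c * ?T c'" by auto
    also have "\<dots> \<in> schur_square C"
      unfolding schur_square_def
      by (rule kvec.span_base) (use c[THEN group_code_translate[OF assms]] k in blast)
    finally show "?T (c * c') \<in> schur_square C" .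
  qed
  ultimately have "schur_square C \<subseteq> {a. ?T a \<in> schur_square C}"
    unfolding schur_square_def[of C] by (intro kvec.span_minimal) (auto simp: schur_square_def)
  thus "?T a \<in> schur_square C" using a by blast
qed

end

theory Submission
  imports Defs "HOL-Algebra.Sylow" "HOL-Algebra.Group_Action" "HOL-Algebra.Left_Coset"
    "HOL-Algebra.Multiplicative_Group"
begin

text \<open>
  Write \<open>\<epsilon>\<close> for the augmentation of \<open>KG\<close>. The hypothesis says exactly that \<open>\<epsilon>\<close> does not vanish on
  the right ideal \<open>D = C * C\<close>. A right ideal \<open>U \<subseteq> D\<close> minimal among those on which \<open>\<epsilon>\<close> does not
  vanish is generated by an idempotent \<open>e\<close>, so it is projective with complement \<open>(1 - e)D\<close> in \<open>D\<close>,
  and minimality makes \<open>U \<inter> ker \<epsilon>\<close> superfluous in \<open>U\<close>.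

  For the dimension bound let \<open>a \<in> D\<close> with \<open>\<epsilon> a \<noteq> 0\<close> and let \<open>S\<close> be a Sylow \<open>p\<close>-subgroup. A nonzero
  annihilator of \<open>a\<close> in \<open>KS\<close> would contain a nonzero vector fixed by \<open>S\<close>, hence the sum of the
  elements of \<open>S\<close>; so all coset sums of \<open>a\<close>, and with them \<open>\<epsilon> a\<close>, would vanish. Therefore
  \<open>aKS \<subseteq> D\<close> has dimension \<open>|S|\<close>.
\<close>

section \<open>Fixed points of p-groups\<close>

text \<open>The permutations in \<open>BijGroup E\<close> are extensional functions, so an ordinary
  action has to be restricted to \<open>E\<close> before it fits.\<close>

lemma group_actionI:
  fixes G (structure)
  assumes "group G"
    and closed: "\<And>g x. g \<in> carrier G \<Longrightarrow> x \<in> E \<Longrightarrow> \<phi> g x \<in> E"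
    and one: "\<And>x. x \<in> E \<Longrightarrow> \<phi> \<one> x = x"
    and mult: "\<And>g h x. g \<in> carrier G \<Longrightarrow> h \<in> carrier G \<Longrightarrow> x \<in> E \<Longrightarrow> \<phi> (g \<otimes> h) x = \<phi> g (\<phi> h x)"
  shows "group_action G E (\<lambda>g. \<lambda>x\<in>E. \<phi> g x)"
proof -
  interpret group G by fact
  have bij: "(\<lambda>x\<in>E. \<phi> g x) \<in> Bij E" if g: "g \<in> carrier G" for g
  proof -
    have "bij_betw (\<phi> g) E E"
    proof (rule bij_betw_byWitness[where f' = "\<phi> (inv g)"])
      show "\<forall>x\<in>E. \<phi> (inv g) (\<phi> g x) = x" "\<forall>x\<in>E. \<phi> g (\<phi> (inv g) x) = x"
        using g one mult[of "inv g" g] mult[of g "inv g"] by simp_all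
    qed (use g closed in auto)
    thus ?thesis by (simp add: Bij_def bij_betw_restrict_eq)
  qed
  have "(\<lambda>g. \<lambda>x\<in>E. \<phi> g x) \<in> hom G (BijGroup E)"
    by (rule homI) (use bij mult closed in \<open>auto simp: BijGroup_def compose_def fun_eq_iff\<close>)
  thus ?thesis
    by (intro group_action.intro group_hom.intro group_hom_axioms.intro group_BijGroup assms(1))
qed

text \<open>The points that are not fixed fall into orbits. By the orbit-stabilizer theorem each of
  these has \<open>p\<close>-power size, and size 1 would mean a fixed point, so \<open>p\<close>
  divides their number.\<close>

lemma (in group_action) p_group_dvd_card_fixed_points:
  assumes "finite E" "prime p" "order G = p ^ n" "p dvd card E"
  shows "p dvd card {x \<in> E. \<forall>g\<in>carrier G. \<phi> g x = x}" (is "_ dvd card ?F")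
proof -
  let ?C = "orbit G \<phi> ` (E - ?F)"
  interpret G: group G using group_hom by (simp add: group_hom_def)
  have orbE: "orbit G \<phi> x \<subseteq> E" if "x \<in> E" for x
    using that element_image by (auto simp: orbit_def)
  have "p dvd card (orbit G \<phi> x)" if x: "x \<in> E - ?F" for x
  proof -
    have "card (orbit G \<phi> x) dvd p ^ n"
      unfolding assms(3)[symmetric] orbit_stabilizer_theorem[OF DiffD1[OF x], symmetric] by simp
    then obtain k where k: "card (orbit G \<phi> x) = p ^ k"
      using assms(2) by (auto simp: divides_primepow_nat)
    have "k \<noteq> 0"
    proof
      assume "k = 0"
      then obtain y where y: "orbit G \<phi> x = {y}" using k by (auto simp: card_1_singleton_iff)
      have "x = y" using y orbit_refl[of x] x by auto
      hence "\<phi> g x = x" if "g \<in> carrier G" for g using y that by (auto simp: orbit_def)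
      thus False using x by auto
    qed
    thus ?thesis using k by (simp add: dvd_power)
  qed
  moreover have "disjnt X Y" if "X \<in> ?C" "Y \<in> ?C" "X \<noteq> Y" for X Y
    using that disjoint_union[of X Y] by (auto simp: orbits_def disjnt_def)
  moreover have U: "\<Union> ?C = E - ?F"
  proof
    show "E - ?F \<subseteq> \<Union> ?C" using orbit_refl by blast
    show "\<Union> ?C \<subseteq> E - ?F"
    proof
      fix y assume "y \<in> \<Union> ?C"
      then obtain x where x: "x \<in> E - ?F" "y \<in> orbit G \<phi> x" by blast
      hence y: "y \<in> E" using orbE by blast
      hence "x \<in> orbit G \<phi> y" using x orbit_sym by blast
      hence "y \<notin> ?F" using x(1) by (force simp: orbit_def)
      thus "y \<in> E - ?F" using y by blast
    qed
  qed
  moreover have "finite (\<Union> ?C)" using U assms(1) by simp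
  ultimately have "p dvd card (E - ?F)"
    using dvd_partition[of ?C p] by (auto simp: disjnt_def)
  moreover have "card E = card (E - ?F) + card ?F"
    using card_Diff_subset[of ?F E] card_mono[of E ?F] assms(1) by (simp add: finite_subset)
  ultimately show ?thesis using assms(4) by (simp add: dvd_add_right_iff)
qed

section \<open>Linear algebra inside a finitely spanned subset\<close>

context vector_space
begin

text \<open>\<open>dim\<close> is the \<open>card\<close> of a basis and thus 0 for an infinite one;
  the finite set \<open>T\<close> rules this out.\<close>

lemma card_le_dim_finite:
  assumes "finite T" "V \<subseteq> span T" "B \<subseteq> V" "independent B"
  shows "finite B \<and> card B \<le> dim V"
proof -
  obtain A where A: "A \<subseteq> V" "independent A" "V \<subseteq> span A" "card A = dim V"
    by (rule basis_exists)
  have "finite A" using independent_span_bound[OF assms(1) A(2)] A(1) assms(2) by blast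
  thus ?thesis using independent_span_bound[OF _ assms(4), of A] A assms(3) by auto
qed

text \<open>A vector of \<open>V\<close> outside \<open>U\<close> would extend a basis of
  \<open>U\<close> to an independent subset of \<open>V\<close> with more than \<open>dim V\<close>
  elements.\<close>

lemma subspace_eq_if_dim_le:
  assumes "finite T" "V \<subseteq> span T" "subspace U" "U \<subseteq> V" "dim V \<le> dim U"
  shows "U = V"
proof (rule ccontr)
  assume "U \<noteq> V"
  then obtain v where v: "v \<in> V" "v \<notin> U" using assms(4) by blast
  obtain A where A: "A \<subseteq> U" "independent A" "U \<subseteq> span A" "card A = dim U"
    by (rule basis_exists)
  have "span A \<subseteq> U" using A(1) assms(3) by (simp add: span_minimal)
  hence "v \<notin> span A" using v by blast
  hence "independent (insert v A)" using A(2) by (simp add: independent_insert)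
  moreover have "insert v A \<subseteq> V" using v A assms(4) by blast
  ultimately have "finite (insert v A) \<and> card (insert v A) \<le> dim V"
    by (intro card_le_dim_finite[OF assms(1,2)])
  moreover have "v \<notin> A" using A(1) v(2) by blast
  ultimately show False using A(4) assms(5) by auto
qed

text \<open>Extend a nonzero kernel vector \<open>x\<close> to a basis \<open>B\<close> of
  \<open>V\<close>. By surjectivity the images of \<open>B - {x}\<close> already span
  \<open>V\<close>, but they are fewer than \<open>card B\<close>.\<close>

lemma linear_surj_on_imp_inj:
  assumes "finite T" "V \<subseteq> span T" and f: "Vector_Spaces.linear scale scale f"
    and surj: "f ` V = V" and x: "x \<in> V" "f x = 0"
  shows "x = 0"
proof (rule ccontr)
  interpret f: Vector_Spaces.linear scale scale f by fact
  assume "x \<noteq> 0"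
  hence "independent {x}" by simp
  moreover have "{x} \<subseteq> V" using x by simp
  ultimately obtain B where "{x} \<subseteq> B" and B: "B \<subseteq> V" "independent B" "V \<subseteq> span B"
    using maximal_independent_subset_extend by metis
  hence xB: "x \<in> B" by simp
  have fin: "finite B" using card_le_dim_finite[OF assms(1,2) B(1,2)] by blast
  have "V \<subseteq> f ` span B" using surj B(3) by (metis image_mono)
  also have "\<dots> = span (f ` B)" by (simp add: f.span_image)
  also have "f ` B = insert 0 (f ` (B - {x}))" using xB x(2) by (metis image_insert insert_Diff)
  also have "span \<dots> = span (f ` (B - {x}))" by simp
  finally have "B \<subseteq> span (f ` (B - {x}))" using B(1) by (rule order_trans[rotated])
  hence "card B \<le> card (f ` (B - {x}))"
    using independent_span_bound[OF _ B(2), of "f ` (B - {x})"] fin by simp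
  also have "\<dots> \<le> card (B - {x})" using fin by (simp add: card_image_le)
  also have "\<dots> < card B" using fin xB by (meson card_Diff1_less)
  finally show False by simp
qed

end

section \<open>Fixed vectors of p-groups in characteristic p\<close>

lemma sum_fun_apply: "(\<Sum>i\<in>S. f i) x = (\<Sum>i\<in>S. f i x)"
  by (induction S rule: infinite_finite_induct) auto

text \<open>For \<open>k\<close> in the group this is \<open>k\<close> itself, seen as an element of
  the group algebra.\<close>

definition basis_vec :: "'a \<Rightarrow> 'a \<Rightarrow> 'k::field" where
  "basis_vec k = (\<lambda>g. if g = k then 1 else 0)"

text \<open>
  The translates of \<open>f\<close> span a finite nonzero vector space over the prime field. Its cardinality is
  divisible by \<open>p\<close>, so \<open>0\<close> cannot be the only fixed point.
\<close>
lemma p_group_fixed_vector: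
  fixes H (structure) and L :: "('h \<Rightarrow> 'k::field) set"
  assumes "group H" "finite (carrier H)" "order H = p ^ n" "prime p" "CHAR('k) = p"
    and L: "kvec.subspace L" "\<And>f g. f \<in> L \<Longrightarrow> g \<notin> carrier H \<Longrightarrow> f g = 0"
    and act: "\<And>f u. f \<in> L \<Longrightarrow> u \<in> carrier H \<Longrightarrow> (\<lambda>g. if g \<in> carrier H then f (g \<otimes> u) else 0) \<in> L"
    and f: "f \<in> L" "f \<noteq> 0"
  obtains c where "c \<noteq> 0" "(\<lambda>g. if g \<in> carrier H then c else 0) \<in> L"
proof -
  interpret group H by fact
  \<comment> \<open>Right translation, which is multiplication by \<open>inv u\<close> from the
    right in the group algebra; in this form \<open>u\<close> acts from the left.\<close>
  define T :: "'h \<Rightarrow> ('h \<Rightarrow> 'k) \<Rightarrow> 'h \<Rightarrow> 'k"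
    where "T u f = (\<lambda>g. if g \<in> carrier H then f (g \<otimes> u) else 0)" for u f
  \<comment> \<open>Natural numbers stand in for the prime field: the range of \<open>comb\<close>
    is the span of the translates of \<open>f\<close> over it.\<close>
  define comb :: "('h \<Rightarrow> nat) \<Rightarrow> 'h \<Rightarrow> 'k"
    where "comb m = (\<Sum>u\<in>carrier H. kscale (of_nat (m u)) (T u f))" for m
  let ?V = "range comb"
  have comb_apply: "comb m g = (\<Sum>u\<in>carrier H. of_nat (m u) * T u f g)" for m g
    by (simp add: comb_def sum_fun_apply kscale_def)
  have VL: "?V \<subseteq> L"
    unfolding comb_def
    by (auto intro!: kvec.subspace_sum kvec.subspace_scale L(1) simp: T_def act f(1))
  have of_nat_p: "of_nat p = (0 :: 'k)" using assms(5) of_nat_CHAR by metis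
  have of_nat_mod: "of_nat (k mod p) = (of_nat k :: 'k)" for k
  proof -
    have "of_nat k = (of_nat (p * (k div p) + k mod p) :: 'k)" by simp
    thus ?thesis unfolding of_nat_add of_nat_mult of_nat_p by simp
  qed
  \<comment> \<open>Only residues modulo \<open>p\<close> matter, which leaves finitely many
    combinations even over an infinite field.\<close>
  have "comb m \<in> comb ` PiE (carrier H) (\<lambda>_. {..<p})" for m
  proof
    show "comb m = comb (\<lambda>u\<in>carrier H. m u mod p)"
      by (simp add: comb_def of_nat_mod)
    show "(\<lambda>u\<in>carrier H. m u mod p) \<in> PiE (carrier H) (\<lambda>_. {..<p})"
      using prime_gt_0_nat[OF assms(4)] by auto
  qed
  hence "?V \<subseteq> comb ` PiE (carrier H) (\<lambda>_. {..<p})" by blast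
  hence fin: "finite ?V"
    by (rule finite_subset) (intro finite_imageI finite_PiE assms(2), simp)
  have comb_add: "comb m + comb m' = comb (\<lambda>u. m u + m' u)" for m m'
    by (simp add: comb_def kscale_def fun_eq_iff sum_fun_apply algebra_simps sum.distrib)
  have zero: "0 = comb (\<lambda>_. 0)" by (simp add: comb_def kscale_def fun_eq_iff sum_fun_apply)
  have fV: "f \<in> ?V"
  proof
    have "comb (\<lambda>u. if u = \<one> then 1 else 0) g = f g" for g
    proof -
      have "comb (\<lambda>u. if u = \<one> then 1 else 0) g = (\<Sum>u\<in>carrier H. if u = \<one> then T \<one> f g else 0)"
        unfolding comb_apply by (rule sum.cong) auto
      thus ?thesis using assms(2) L(2)[OF f(1)] by (simp add: T_def)
    qed
    thus "f = comb (\<lambda>u. if u = \<one> then 1 else 0)" by auto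
  qed simp
  \<comment> \<open>Translation by \<open>w\<close> merely permutes the coefficients, so the span is
    stable under the action.\<close>
  have T_comb: "T w (comb m) = comb (\<lambda>u. m (inv w \<otimes> u))" if w: "w \<in> carrier H" for w m
  proof
    fix g
    show "T w (comb m) g = comb (\<lambda>u. m (inv w \<otimes> u)) g"
    proof (cases "g \<in> carrier H")
      case g: True
      have "T w (comb m) g = (\<Sum>u\<in>carrier H. of_nat (m u) * T u f (g \<otimes> w))"
        using g by (simp add: T_def[of w] comb_apply)
      also have "\<dots> = (\<Sum>u\<in>carrier H. of_nat (m (inv w \<otimes> (w \<otimes> u))) * T (w \<otimes> u) f g)"
      proof (rule sum.cong[OF refl])
        fix u assume u: "u \<in> carrier H"
        have "inv w \<otimes> (w \<otimes> u) = u" using w u by (simp add: m_assoc[symmetric])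
        thus "of_nat (m u) * T u f (g \<otimes> w) = of_nat (m (inv w \<otimes> (w \<otimes> u))) * T (w \<otimes> u) f g"
          using g w u by (simp add: T_def m_assoc)
      qed
      also have "\<dots> = (\<Sum>u\<in>carrier H. of_nat (m (inv w \<otimes> u)) * T u f g)"
        by (rule sum_translate[OF w])
      finally show ?thesis by (simp add: comb_apply)
    qed (simp add: T_def comb_apply)
  qed
  interpret V: group_action H ?V "\<lambda>g. \<lambda>x\<in>?V. T g x"
  proof (rule group_actionI)
    show "T g x \<in> ?V" if "g \<in> carrier H" "x \<in> ?V" for g x using T_comb that by auto
    show "T \<one> x = x" if "x \<in> ?V" for x
      using L(2) VL that by (fastforce simp: T_def fun_eq_iff)
    show "T (g \<otimes> h) x = T g (T h x)" if "g \<in> carrier H" "h \<in> carrier H" for g h x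
      using that by (auto simp: T_def fun_eq_iff m_assoc)
  qed fact
  have "p dvd card ?V"
  proof -
    \<comment> \<open>In the additive group of the span the nonzero element \<open>f\<close> has
      order \<open>p\<close>, and Lagrange's theorem applies.\<close>
    let ?A = "\<lparr>carrier = ?V, monoid.mult = (+), one = 0\<rparr>"
    have neg: "comb (\<lambda>u. (p - 1) * m u) + comb m = 0" for m
    proof -
      have "(\<lambda>u. (p - 1) * m u + m u) = (\<lambda>u. p * m u)"
        using prime_gt_0_nat[OF assms(4)] by (cases p) auto
      hence "comb (\<lambda>u. (p - 1) * m u) + comb m = comb (\<lambda>u. p * m u)" by (simp only: comb_add)
      also have "\<dots> = 0" by (simp add: comb_def kscale_def fun_eq_iff sum_fun_apply of_nat_p)
      finally show ?thesis .
    qed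
    interpret A: group ?A
    proof (rule groupI)
      show "\<exists>y\<in>carrier ?A. y \<otimes>\<^bsub>?A\<^esub> x = \<one>\<^bsub>?A\<^esub>" if "x \<in> carrier ?A" for x
        using that neg by auto
    qed (use comb_add zero in \<open>auto simp: add.assoc\<close>)
    have pow: "x [^]\<^bsub>?A\<^esub> k = kscale (of_nat k) x" for x and k :: nat
      by (induction k) (auto simp: kscale_def fun_eq_iff algebra_simps)
    have "A.ord f dvd p"
      using A.pow_eq_id[of f p] fV by (auto simp: pow kscale_def fun_eq_iff of_nat_p)
    moreover have "A.ord f \<noteq> 1" using A.ord_eq_1[of f] fV f(2) by auto
    ultimately have "A.ord f = p" using assms(4) by (auto simp: prime_nat_iff)
    thus ?thesis using A.ord_dvd_group_order[of f] fV by (simp add: order_def)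
  qed
  hence "p dvd card {x \<in> ?V. \<forall>g\<in>carrier H. (\<lambda>x\<in>?V. T g x) x = x}" (is "_ dvd card ?F")
    by (rule V.p_group_dvd_card_fixed_points[OF fin assms(4,3)])
  have "0 \<in> ?F" using zero by (auto simp: T_def fun_eq_iff)
  have "?F \<noteq> {0}"
  proof
    assume "?F = {0}"
    hence "card ?F = 1" by simp
    with \<open>p dvd card ?F\<close> show False using prime_gt_1_nat[OF assms(4)] by simp
  qed
  with \<open>0 \<in> ?F\<close> obtain v where "v \<in> ?F" and v0: "v \<noteq> 0" by blast
  hence v: "v \<in> ?V" "\<And>g. g \<in> carrier H \<Longrightarrow> T g v = v" by auto
  \<comment> \<open>Evaluating \<open>T g v = v\<close> at the identity shows that a fixed vector is
    constant on the group.\<close>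
  have "v = (\<lambda>g. if g \<in> carrier H then v \<one> else 0)"
  proof
    fix g show "v g = (if g \<in> carrier H then v \<one> else 0)"
      using fun_cong[OF v(2)[of g], of \<one>] L(2)[of v g] VL v(1) by (auto simp: T_def)
  qed
  moreover from this have "v \<one> \<noteq> 0" using v0 by (metis zero_fun_apply ext)
  moreover have "v \<in> L" using v(1) VL by blast
  ultimately show ?thesis using that by metis
qed

section \<open>Right ideals of the group algebra as subspaces\<close>

context
  fixes G :: "('g, 's) monoid_scheme" (structure)
  assumes G: "group G" and finite_G: "finite (carrier G)"
begin

interpretation group G by (rule G)

abbreviation KG :: "('g \<Rightarrow> 'k::field) ring" where
  "KG \<equiv> group_algebra G"

definition aug :: "('g \<Rightarrow> 'k::field) \<Rightarrow> 'k" where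
  "aug a = (\<Sum>g\<in>carrier G. a g)"

lemma KG_ring: "ring (KG :: ('g \<Rightarrow> 'k::field) ring)"
  using G finite_G by (rule group_algebra_ring)

lemma zero_KG [simp]: "\<zero>\<^bsub>KG\<^esub> = (0 :: 'g \<Rightarrow> 'k::field)"
  by (simp add: group_algebra_def zero_fun_def)

lemma add_KG [simp]: "a \<oplus>\<^bsub>KG\<^esub> b = (a + b :: 'g \<Rightarrow> 'k::field)"
  by (simp add: group_algebra_def plus_fun_def)

lemma code_rmodule_sel [simp]:
  "carrier (code_rmodule G U) = U" "\<zero>\<^bsub>code_rmodule G U\<^esub> = 0"
  "a \<oplus>\<^bsub>code_rmodule G U\<^esub> b = a + b" "a \<odot>\<^sub>r\<^bsub>code_rmodule G U\<^esub> b = a \<otimes>\<^bsub>KG\<^esub> b"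
  for a b :: "'g \<Rightarrow> 'k::field"
  by (simp_all add: code_rmodule_def regular_rmodule_def)

lemma trivial_rmodule_sel [simp]:
  "carrier (trivial_rmodule G :: ('g \<Rightarrow> 'k::field, 'k) rmodule) = UNIV"
  "\<zero>\<^bsub>trivial_rmodule G\<^esub> = (0 :: 'k)"
  "c \<oplus>\<^bsub>trivial_rmodule G\<^esub> d = (c + d :: 'k)"
  "c \<odot>\<^sub>r\<^bsub>trivial_rmodule G\<^esub> a = c * aug a"
  by (simp_all add: trivial_rmodule_def aug_def)

lemma aug_add: "aug (a + b) = aug a + aug b"
  by (simp add: aug_def sum.distrib)

lemma aug_kscale: "aug (kscale c a) = c * aug a"
  by (simp add: aug_def kscale_def sum_distrib_left)

text \<open>This is associativity of the action on the trivial module, applied to the vector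
  1.\<close>

lemma aug_mult:
  fixes a b :: "'g \<Rightarrow> 'k::field"
  assumes "a \<in> carrier KG" "b \<in> carrier KG"
  shows "aug (a \<otimes>\<^bsub>KG\<^esub> b) = aug a * aug b"
proof -
  interpret right_module KG "trivial_rmodule G :: ('g \<Rightarrow> 'k, 'k) rmodule"
    using G finite_G by (rule trivial_rmodule_right_module)
  show ?thesis using rsmult_assoc[of 1 a b] assms by simp
qed

lemma KG_linear: "Vector_Spaces.linear kscale kscale (\<lambda>x :: 'g \<Rightarrow> 'k::field. a \<otimes>\<^bsub>KG\<^esub> x)"
  by (auto simp: Vector_Spaces.linear_iff kvec.vector_space_axioms group_algebra_def kscale_def fun_eq_iff
      algebra_simps sum.distrib sum_distrib_left)

lemma KG_subspace: "kvec.subspace (carrier KG :: ('g \<Rightarrow> 'k::field) set)"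
  by (auto simp: kvec.subspace_def group_algebra_def kscale_def)

lemma basis_vec_KG: "k \<in> carrier G \<Longrightarrow> basis_vec k \<in> carrier KG"
  by (auto simp: basis_vec_def group_algebra_def)

lemma sum_kscale_basis_vec:
  assumes "finite S"
  shows "(\<Sum>k\<in>S. kscale (c k) (basis_vec k)) = (\<lambda>g. if g \<in> S then c g else 0 :: 'k::field)"
proof
  have "(\<Sum>k\<in>S. kscale (c k) (basis_vec k)) g = (\<Sum>k\<in>S. if k = g then c k else 0)" for g
    by (auto simp: sum_fun_apply kscale_def basis_vec_def intro!: sum.cong)
  thus "(\<Sum>k\<in>S. kscale (c k) (basis_vec k)) g = (if g \<in> S then c g else 0)" for g
    using assms by simp
qed

lemma KG_span: "(carrier KG :: ('g \<Rightarrow> 'k::field) set) \<subseteq> kvec.span (basis_vec ` carrier G)"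
proof
  fix a :: "'g \<Rightarrow> 'k" assume "a \<in> carrier KG"
  hence "a = (\<Sum>k\<in>carrier G. kscale (a k) (basis_vec k))"
    by (subst sum_kscale_basis_vec[OF finite_G]) (auto simp: group_algebra_def)
  also have "\<dots> \<in> kvec.span (basis_vec ` carrier G)"
    by (intro kvec.span_sum kvec.span_scale kvec.span_base) auto
  finally show "a \<in> kvec.span (basis_vec ` carrier G)" .
qed

lemma mult_scaled_one:
  fixes a :: "'g \<Rightarrow> 'k::field"
  assumes "a \<in> carrier KG"
  shows "a \<otimes>\<^bsub>KG\<^esub> kscale c \<one>\<^bsub>KG\<^esub> = kscale c a"
proof -
  interpret ring "KG :: ('g \<Rightarrow> 'k) ring" by (rule KG_ring)
  interpret l: Vector_Spaces.linear kscale kscale "\<lambda>x. a \<otimes>\<^bsub>KG\<^esub> x" by (rule KG_linear)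
  show ?thesis using assms by (simp add: l.scale)
qed

text \<open>Submodules are only required to be additive subgroups. Closure under field scalars
  follows because scaling by \<open>c\<close> is right multiplication by \<open>c\<close> times the
  unit of \<open>KG\<close>; this opens submodules to dimension arguments.\<close>

lemma right_submodule_code_rmodule_iff:
  fixes U V :: "('g \<Rightarrow> 'k::field) set"
  assumes U: "right_module KG (code_rmodule G U)" "U \<subseteq> carrier KG"
  shows "right_submodule KG (code_rmodule G U) V \<longleftrightarrow>
    V \<subseteq> U \<and> kvec.subspace V \<and> (\<forall>a\<in>V. \<forall>b\<in>carrier KG. a \<otimes>\<^bsub>KG\<^esub> b \<in> V)"
    (is "?L \<longleftrightarrow> ?R")
proof -
  interpret R: ring "KG :: ('g \<Rightarrow> 'k) ring" by (rule KG_ring)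
  interpret M: right_module KG "code_rmodule G U" by (rule U)
  have scaled: "kscale c \<one>\<^bsub>KG\<^esub> \<in> carrier KG" for c :: 'k
    using kvec.subspace_scale[OF KG_subspace R.one_closed] .
  show ?thesis
  proof
    assume ?L
    then interpret V: additive_subgroup V "code_rmodule G U" by (simp add: right_submodule_def)
    have mult: "a \<otimes>\<^bsub>KG\<^esub> b \<in> V" if "a \<in> V" "b \<in> carrier KG" for a b
      using \<open>?L\<close> that by (simp add: right_submodule_def)
    have "V \<subseteq> U" using V.a_subset by simp
    moreover have "kvec.subspace V"
    proof (rule kvec.subspaceI)
      show "0 \<in> V" using V.zero_closed by simp
      show "x + y \<in> V" if "x \<in> V" "y \<in> V" for x y using V.a_closed[OF that] by simp
      show "kscale c x \<in> V" if "x \<in> V" for c x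
      proof -
        have "x \<in> carrier KG" using that \<open>V \<subseteq> U\<close> U(2) by blast
        thus ?thesis using mult[OF that scaled[of c]] by (simp add: mult_scaled_one)
      qed
    qed
    ultimately show ?R using mult by blast
  next
    assume R: ?R
    have neg: "\<ominus>\<^bsub>code_rmodule G U\<^esub> x = - x" if "x \<in> V" for x
      by (rule M.M.minus_equality)
        (use that R kvec.subspace_neg[of V x] in auto)
    have "additive_subgroup V (code_rmodule G U)"
      by (rule additive_subgroupI')
        (use R M.M.abelian_group_axioms neg kvec.subspace_0[of V] kvec.subspace_add[of V]
          kvec.subspace_neg[of V] in auto)
    thus ?L using R by (simp add: right_submodule_def)
  qed
qed

lemma code_rmodule_KG: "code_rmodule G (carrier KG) = regular_rmodule KG"
  by (simp add: code_rmodule_def regular_rmodule_def)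

lemma group_code_iff:
  fixes C :: "('g \<Rightarrow> 'k::field) set"
  shows "group_code G C \<longleftrightarrow>
    C \<subseteq> carrier KG \<and> kvec.subspace C \<and> (\<forall>a\<in>C. \<forall>b\<in>carrier KG. a \<otimes>\<^bsub>KG\<^esub> b \<in> C)"
  using right_submodule_code_rmodule_iff[of "carrier KG" C] regular_rmodule_right_module[OF KG_ring]
  by (simp add: group_code_def code_rmodule_KG)

lemma right_submodule_code_iff:
  fixes U V :: "('g \<Rightarrow> 'k::field) set"
  assumes "group_code G U"
  shows "right_submodule KG (code_rmodule G U) V \<longleftrightarrow> group_code G V \<and> V \<subseteq> U"
  using right_submodule_code_rmodule_iff[of U V] code_rmodule_right_module[OF G finite_G assms] assms
  by (auto simp: group_code_iff)

text \<open>Left multiplication by \<open>a\<close> commutes with right multiplications, by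
  associativity.\<close>

lemma group_code_mult_image:
  fixes U :: "('g \<Rightarrow> 'k::field) set"
  assumes "group_code G U" "a \<in> carrier KG"
  shows "group_code G ((\<lambda>x. a \<otimes>\<^bsub>KG\<^esub> x) ` U)"
proof -
  interpret R: ring "KG :: ('g \<Rightarrow> 'k) ring" by (rule KG_ring)
  interpret l: Vector_Spaces.linear kscale kscale "\<lambda>x. a \<otimes>\<^bsub>KG\<^esub> x" by (rule KG_linear)
  have U: "U \<subseteq> carrier KG" "kvec.subspace U" "\<And>a b. a \<in> U \<Longrightarrow> b \<in> carrier KG \<Longrightarrow> a \<otimes>\<^bsub>KG\<^esub> b \<in> U"
    using assms(1) by (auto simp: group_code_iff)
  have "a \<otimes>\<^bsub>KG\<^esub> x \<otimes>\<^bsub>KG\<^esub> b \<in> (\<lambda>x. a \<otimes>\<^bsub>KG\<^esub> x) ` U" if "x \<in> U" "b \<in> carrier KG" for x b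
    using that U assms(2) R.m_assoc[of a x b] by auto
  thus ?thesis using U assms(2) l.subspace_image[of U] by (auto simp: group_code_iff)
qed

text \<open>The kernel counterpart of \<open>group_code_mult_image\<close>. It yields the complement
  of the projective summand and the translation invariance in the dimension bound.\<close>

lemma group_code_annihilator:
  fixes U :: "('g \<Rightarrow> 'k::field) set"
  assumes "group_code G U" "a \<in> carrier KG"
  shows "group_code G {x \<in> U. a \<otimes>\<^bsub>KG\<^esub> x = 0}"
proof -
  interpret R: ring "KG :: ('g \<Rightarrow> 'k) ring" by (rule KG_ring)
  interpret l: Vector_Spaces.linear kscale kscale "\<lambda>x. a \<otimes>\<^bsub>KG\<^esub> x" by (rule KG_linear)
  have U: "U \<subseteq> carrier KG" "kvec.subspace U" "\<And>a b. a \<in> U \<Longrightarrow> b \<in> carrier KG \<Longrightarrow> a \<otimes>\<^bsub>KG\<^esub> b \<in> U"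
    using assms(1) by (auto simp: group_code_iff)
  have "a \<otimes>\<^bsub>KG\<^esub> (x \<otimes>\<^bsub>KG\<^esub> b) = 0" if "x \<in> U" "b \<in> carrier KG" "a \<otimes>\<^bsub>KG\<^esub> x = 0" for x b
    using that U(1) assms(2) R.m_assoc[of a x b] R.l_null[of b] by auto
  moreover have "kvec.subspace {x \<in> U. a \<otimes>\<^bsub>KG\<^esub> x = 0}"
    using U(2) by (auto simp: kvec.subspace_def l.add l.scale)
  ultimately show ?thesis using U by (auto simp: group_code_iff)
qed

section \<open>The projective cover of the trivial module as a direct summand\<close>

text \<open>The competitors are only the right ideals on which \<open>aug\<close> does not vanish;
  \<open>U\<close> may well contain smaller nonzero right ideals.\<close>

definition aug_minimal :: "('g \<Rightarrow> 'k::field) set \<Rightarrow> bool" where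
  "aug_minimal U \<longleftrightarrow> group_code G U \<and> (\<exists>x\<in>U. aug x \<noteq> 0) \<and>
     (\<forall>V. group_code G V \<and> V \<subseteq> U \<and> (\<exists>x\<in>V. aug x \<noteq> 0) \<longrightarrow> V = U)"

text \<open>Take a candidate of least dimension; a candidate inside it has the same dimension and so
  coincides with it.\<close>

lemma aug_minimal_exists:
  fixes D :: "('g \<Rightarrow> 'k::field) set"
  assumes "group_code G D" "x \<in> D" "aug x \<noteq> 0"
  obtains U where "aug_minimal U" "U \<subseteq> D"
proof -
  let ?P = "\<lambda>U :: ('g \<Rightarrow> 'k) set. group_code G U \<and> U \<subseteq> D \<and> (\<exists>x\<in>U. aug x \<noteq> 0)"
  have "?P D" using assms by blast
  from ex_has_least_nat[of ?P, OF this, of kvec.dim]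
  obtain U where U: "?P U" "\<And>V. ?P V \<Longrightarrow> kvec.dim U \<le> kvec.dim V" by blast
  have "V = U" if V: "group_code G V" "V \<subseteq> U" "\<exists>x\<in>V. aug x \<noteq> 0" for V
  proof (rule kvec.subspace_eq_if_dim_le)
    show "finite (basis_vec ` carrier G)" using finite_G by simp
    show "U \<subseteq> kvec.span (basis_vec ` carrier G)" using U(1) KG_span by (auto simp: group_code_iff)
    show "kvec.subspace V" using V(1) by (simp add: group_code_iff)
    show "kvec.dim U \<le> kvec.dim V" using U V by blast
  qed (rule V(2))
  hence "aug_minimal U" using U(1) by (auto simp: aug_minimal_def)
  thus ?thesis using U(1) that by blast
qed

text \<open>
  Brauer's argument: a left multiplication by an element of nonzero augmentation maps the minimal
  right ideal onto itself, hence injectively, and the preimage of the multiplier is idempotent.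
\<close>
lemma aug_minimal_idempotent:
  fixes U :: "('g \<Rightarrow> 'k::field) set"
  assumes "aug_minimal U"
  obtains e where "e \<in> U" "aug e \<noteq> 0" "\<forall>x\<in>U. e \<otimes>\<^bsub>KG\<^esub> x = x"
proof -
  interpret R: ring "KG :: ('g \<Rightarrow> 'k) ring" by (rule KG_ring)
  have code: "group_code G U" using assms by (simp add: aug_minimal_def)
  hence U: "U \<subseteq> carrier KG" "kvec.subspace U" "\<And>a b. a \<in> U \<Longrightarrow> b \<in> carrier KG \<Longrightarrow> a \<otimes>\<^bsub>KG\<^esub> b \<in> U"
    by (auto simp: group_code_iff)
  have surj: "(\<lambda>x. a \<otimes>\<^bsub>KG\<^esub> x) ` U = U" if a: "a \<in> U" "aug a \<noteq> 0" for a
  proof -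
    have "group_code G ((\<lambda>x. a \<otimes>\<^bsub>KG\<^esub> x) ` U)" using group_code_mult_image[OF code] a U(1) by blast
    moreover have "(\<lambda>x. a \<otimes>\<^bsub>KG\<^esub> x) ` U \<subseteq> U" using U a by auto
    \<comment> \<open>The square of \<open>a\<close> lies in the image and has augmentation
      \<open>aug a\<close> squared, so minimality applies to the image.\<close>
    moreover have "aug (a \<otimes>\<^bsub>KG\<^esub> a) \<noteq> 0" using a U(1) aug_mult[of a a] by auto
    ultimately show ?thesis using assms a(1) unfolding aug_minimal_def by blast
  qed
  obtain a where a: "a \<in> U" "aug a \<noteq> 0" using assms by (auto simp: aug_minimal_def)
  obtain e where e: "e \<in> U" "a \<otimes>\<^bsub>KG\<^esub> e = a" using surj[OF a] a(1) by (metis imageE)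
  have "aug a = aug a * aug e" using aug_mult[of a e] e a(1) U(1) by (simp add: subset_iff)
  hence aug_e: "aug e \<noteq> 0" using a(2) by auto
  have "e \<otimes>\<^bsub>KG\<^esub> x = x" if x: "x \<in> U" for x
  proof -
    interpret l: Vector_Spaces.linear kscale kscale "\<lambda>x :: 'g \<Rightarrow> 'k. a \<otimes>\<^bsub>KG\<^esub> x" by (rule KG_linear)
    have c: "a \<in> carrier KG" "e \<in> carrier KG" "x \<in> carrier KG" using a e x U(1) by auto
    have ex: "e \<otimes>\<^bsub>KG\<^esub> x \<in> U" using U(3) e c by blast
    \<comment> \<open>Since \<open>a\<close> times \<open>e\<close> is \<open>a\<close>, left
      multiplication by \<open>a\<close> kills this difference. Injectivity on \<open>U\<close> then
      makes \<open>e\<close> a left identity of \<open>U\<close>.\<close>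
    have "a \<otimes>\<^bsub>KG\<^esub> (e \<otimes>\<^bsub>KG\<^esub> x - x) = 0"
      using R.m_assoc[OF c] e(2) by (simp add: l.diff)
    moreover have "e \<otimes>\<^bsub>KG\<^esub> x - x \<in> U" using kvec.subspace_diff[OF U(2) ex x] .
    ultimately have "e \<otimes>\<^bsub>KG\<^esub> x - x = 0"
      using kvec.linear_surj_on_imp_inj[of "basis_vec ` carrier G" U, OF _ _ KG_linear surj[OF a]]
        KG_span U(1) finite_G by (metis finite_imageI order_trans)
    thus ?thesis by simp
  qed
  thus ?thesis using that e(1) aug_e by blast
qed

text \<open>A homomorphism \<open>f\<close> on \<open>U\<close> is determined by \<open>f e\<close>,
  as \<open>f x = f (e x)\<close> is \<open>f e\<close> acted on by \<open>x\<close>. A preimage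
  \<open>n\<close> of \<open>f e\<close> thus gives the lift sending \<open>x\<close> to
  \<open>n\<close> acted on by \<open>x\<close>.\<close>

lemma projective_code_if_left_unit:
  fixes U :: "('g \<Rightarrow> 'k::field) set"
  assumes code: "group_code G U" and e: "e \<in> U" "\<forall>x\<in>U. e \<otimes>\<^bsub>KG\<^esub> x = x"
  shows "projective_rmodule KG (code_rmodule G U)"
  unfolding projective_rmodule_def
proof (intro conjI allI impI)
  show "right_module KG (code_rmodule G U)"
    using G finite_G code by (rule code_rmodule_right_module)
  have U: "U \<subseteq> carrier KG" using code by (simp add: group_code_iff)
  fix N :: "('g \<Rightarrow> 'k, ('g \<Rightarrow> 'k) \<Rightarrow> 'g \<Rightarrow> 'k) rmodule"
    and Q :: "('g \<Rightarrow> 'k, 'g \<Rightarrow> 'k) rmodule" and \<pi> f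
  assume *: "right_module KG N \<and> right_module KG Q \<and> \<pi> \<in> rmod_hom KG N Q \<and>
    \<pi> ` carrier N = carrier Q \<and> f \<in> rmod_hom KG (code_rmodule G U) Q"
  then interpret N: right_module KG N by blast
  have \<pi>: "\<pi> \<in> rmod_hom KG N Q" and f: "f \<in> rmod_hom KG (code_rmodule G U) Q" using * by auto
  have "f e \<in> \<pi> ` carrier N" using * e(1) rmod_homD(1)[OF f, of e] by simp
  then obtain n where n: "n \<in> carrier N" "\<pi> n = f e" by (metis imageE)
  have "(\<lambda>x. n \<odot>\<^sub>r\<^bsub>N\<^esub> x) \<in> rmod_hom KG (code_rmodule G U) N"
    using n(1) U N.rsmult_r_distr[of n] N.rsmult_assoc[of n]
    by (auto simp: rmod_hom_def subset_iff)
  moreover have "\<pi> (n \<odot>\<^sub>r\<^bsub>N\<^esub> x) = f x" if "x \<in> U" for x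
    using rmod_homD(3)[OF \<pi> n(1), of x] rmod_homD(3)[OF f, of e x] that U e n(2) by auto
  ultimately show "\<exists>h\<in>rmod_hom KG (code_rmodule G U) N.
      \<forall>x\<in>carrier (code_rmodule G U). \<pi> (h x) = f x"
    by (intro bexI[of _ "\<lambda>x. n \<odot>\<^sub>r\<^bsub>N\<^esub> x"]) simp_all
qed

text \<open>The covering map is \<open>aug\<close>. If its kernel and \<open>V\<close> together sum
  to \<open>U\<close>, the \<open>V\<close>-component of \<open>e\<close> has the augmentation of
  \<open>e\<close>, which is nonzero, and minimality forces \<open>V = U\<close>.\<close>

lemma aug_minimal_projective_cover:
  fixes U :: "('g \<Rightarrow> 'k::field) set"
  assumes "aug_minimal U"
  shows "projective_cover KG (code_rmodule G U) (trivial_rmodule G :: ('g \<Rightarrow> 'k, 'k) rmodule)"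
proof -
  obtain e where e: "e \<in> U" "aug e \<noteq> 0" "\<forall>x\<in>U. e \<otimes>\<^bsub>KG\<^esub> x = x"
    using assms by (rule aug_minimal_idempotent)
  have code: "group_code G U" using assms by (simp add: aug_minimal_def)
  hence U: "U \<subseteq> carrier KG" "kvec.subspace U" "\<And>a b. a \<in> U \<Longrightarrow> b \<in> carrier KG \<Longrightarrow> a \<otimes>\<^bsub>KG\<^esub> b \<in> U"
    by (auto simp: group_code_iff)
  have hom: "aug \<in> rmod_hom KG (code_rmodule G U) (trivial_rmodule G :: ('g \<Rightarrow> 'k, 'k) rmodule)"
    using U(1) by (auto simp: rmod_hom_def aug_add aug_mult subset_iff)
  have "c \<in> aug ` U" for c
  proof
    \<comment> \<open>Rescaling \<open>e\<close> reaches every scalar.\<close>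
    show "c = aug (kscale (c / aug e) e)" using e(2) by (simp add: aug_kscale)
    show "kscale (c / aug e) e \<in> U" using kvec.subspace_scale[OF U(2) e(1)] .
  qed
  hence surj: "aug ` U = UNIV" by blast
  let ?K = "{x \<in> U. aug x = 0}"
  have "kvec.subspace ?K"
    using U(2) by (auto simp: kvec.subspace_def aug_add aug_kscale) (simp add: aug_def)
  hence "group_code G ?K" using U by (auto simp: group_code_iff aug_mult subset_iff)
  moreover have "V = U"
    if V: "group_code G V" "V \<subseteq> U" "?K <+>\<^bsub>code_rmodule G U\<^esub> V = U" for V
  proof -
    have "e \<in> ?K <+>\<^bsub>code_rmodule G U\<^esub> V" using e(1) V(3) by simp
    then obtain k v where "e = k + v" "k \<in> ?K" "v \<in> V"
      by (auto simp: set_add_def set_mult_def)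
    hence "\<exists>v\<in>V. aug v \<noteq> 0" using e(2) by (auto simp: aug_add)
    thus ?thesis using V assms by (simp add: aug_minimal_def)
  qed
  ultimately have "superfluous_submodule KG (code_rmodule G U) ?K"
    by (auto simp: superfluous_submodule_def right_submodule_code_iff[OF code])
  thus ?thesis
    unfolding projective_cover_def
    using hom surj projective_code_if_left_unit[OF code e(1,3)]
      trivial_rmodule_right_module[OF G finite_G]
    by (intro conjI bexI[of _ aug]) simp_all
qed

text \<open>Peirce decomposition: \<open>x\<close> is the sum of \<open>e x\<close> in
  \<open>U\<close> and \<open>x - e x\<close>, which \<open>e\<close> annihilates because it fixes
  \<open>e x\<close>.\<close>

lemma left_unit_direct_summand:
  fixes U D :: "('g \<Rightarrow> 'k::field) set"
  assumes code: "group_code G U" "group_code G D" and "U \<subseteq> D"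
    and e: "e \<in> U" "\<forall>x\<in>U. e \<otimes>\<^bsub>KG\<^esub> x = x"
  shows "rmod_direct_sum KG (code_rmodule G D) U {x \<in> D. e \<otimes>\<^bsub>KG\<^esub> x = 0}" (is "rmod_direct_sum _ _ _ ?M")
proof -
  interpret l: Vector_Spaces.linear kscale kscale "\<lambda>x :: 'g \<Rightarrow> 'k. e \<otimes>\<^bsub>KG\<^esub> x" by (rule KG_linear)
  have U: "U \<subseteq> carrier KG" "kvec.subspace U" "\<And>a b. a \<in> U \<Longrightarrow> b \<in> carrier KG \<Longrightarrow> a \<otimes>\<^bsub>KG\<^esub> b \<in> U"
    and D: "D \<subseteq> carrier KG" "kvec.subspace D"
    using code by (auto simp: group_code_iff)
  have "x \<in> U <+>\<^bsub>code_rmodule G D\<^esub> ?M" if x: "x \<in> D" for x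
  proof -
    have ex: "e \<otimes>\<^bsub>KG\<^esub> x \<in> U" using U(3) e(1) x D(1) by blast
    moreover have "x - e \<otimes>\<^bsub>KG\<^esub> x \<in> ?M"
      using kvec.subspace_diff[OF D(2) x, of "e \<otimes>\<^bsub>KG\<^esub> x"] ex bspec[OF e(2) ex] assms(3)
      by (auto simp: l.diff)
    moreover have "x = e \<otimes>\<^bsub>KG\<^esub> x + (x - e \<otimes>\<^bsub>KG\<^esub> x)" by simp
    ultimately show ?thesis unfolding set_add_def set_mult_def by force
  qed
  moreover have "U <+>\<^bsub>code_rmodule G D\<^esub> ?M \<subseteq> D"
    using assms(3) kvec.subspace_add[OF D(2)] by (auto simp: set_add_def set_mult_def)
  moreover have "U \<inter> ?M = {0}"
    using e(2) kvec.subspace_0 U(2) D(2) l.zero by force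
  moreover have "group_code G ?M"
    using group_code_annihilator[OF code(2), of e] e(1) U(1) by blast
  ultimately show ?thesis
    using code assms(3) by (auto simp: rmod_direct_sum_def right_submodule_code_iff)
qed


section \<open>The dimension bound from a Sylow subgroup\<close>

lemma aug_eq_0_if_coset_sums_eq_0:
  fixes a :: "'g \<Rightarrow> 'k::field"
  assumes S: "subgroup S G" and 0: "\<And>g. g \<in> carrier G \<Longrightarrow> (\<Sum>h\<in>g <# S. a h) = 0"
  shows "aug a = 0"
proof -
  have fin: "finite X" if "X \<in> lcosets S" for X
    using subgroup.lcosets_carrier[OF S G that] finite_G by (rule finite_subset)
  have "aug a = sum a (\<Union> (lcosets S))"
    by (simp add: aug_def lcosets_part_G[OF S])
  also have "\<dots> = sum (sum a) (lcosets S)"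
    using sum.Union_disjoint[of "lcosets S" a] fin lcos_disjoint[OF S] by auto
  also have "\<dots> = 0"
    by (rule sum.neutral) (use 0 in \<open>auto simp: LCOSETS_def\<close>)
  finally show ?thesis .
qed

text \<open>Injectivity of left multiplication by \<open>a\<close> on \<open>KS\<close>, realized as
  the functions supported on \<open>S\<close>. A nonzero kernel would contain a nonzero constant on
  \<open>S\<close>.\<close>

lemma p_subgroup_mult_inj:
  fixes a f :: "'g \<Rightarrow> 'k::field"
  assumes S: "subgroup S G" "card S = p ^ n" and p: "prime p" "CHAR('k) = p"
    and a: "a \<in> carrier KG" "aug a \<noteq> 0"
    and f: "\<And>g. g \<notin> S \<Longrightarrow> f g = 0" "a \<otimes>\<^bsub>KG\<^esub> f = 0"
  shows "f = 0"
proof (rule ccontr)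
  assume "f \<noteq> 0"
  let ?H = "G\<lparr>carrier := S\<rparr>"
  interpret S: subgroup S G by (rule S)
  interpret l: Vector_Spaces.linear kscale kscale "\<lambda>x :: 'g \<Rightarrow> 'k. a \<otimes>\<^bsub>KG\<^esub> x"
    by (rule KG_linear)
  define L where "L = {f. (\<forall>g. g \<notin> S \<longrightarrow> f g = 0) \<and> a \<otimes>\<^bsub>KG\<^esub> f = 0}"
  have LKG: "L \<subseteq> carrier KG" using S.subset by (auto simp: L_def group_algebra_def)
  have ann: "group_code G {x \<in> carrier KG. a \<otimes>\<^bsub>KG\<^esub> x = 0}"
    by (rule group_code_annihilator[OF _ a(1)])
      (auto simp: group_code_iff KG_subspace
        ring.ring_simprules(5)[OF KG_ring])
  obtain c where c: "c \<noteq> 0" "(\<lambda>g. if g \<in> carrier ?H then c else 0) \<in> L"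
  proof (rule p_group_fixed_vector[of ?H p n L f])
    show "group ?H" using S.subgroup_is_group[OF G] .
    show "finite (carrier ?H)" using finite_G S.subset finite_subset by auto
    show "order ?H = p ^ n" using S(2) by (simp add: order_def)
    show "kvec.subspace L"
    proof (rule kvec.subspaceI)
      show "kscale c x \<in> L" if "x \<in> L" for c x
        using that by (simp add: L_def l.scale) (simp add: kscale_def)
    qed (simp_all add: L_def l.add)
    show "f \<in> L" using f by (simp add: L_def)
    show "(\<lambda>g. if g \<in> carrier ?H then x (g \<otimes>\<^bsub>?H\<^esub> u) else 0) \<in> L"
      if x: "x \<in> L" and u: "u \<in> carrier ?H" for x u
    proof -
      \<comment> \<open>Translation by an element of \<open>S\<close> preserves the support
        condition, so translating within \<open>S\<close> agrees with translating in
        \<open>G\<close>, where the annihilator of \<open>a\<close> is a right ideal.\<close>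
      have iff: "g \<otimes> u \<in> S \<longleftrightarrow> g \<in> S" if g: "g \<in> carrier G" for g
      proof
        assume "g \<otimes> u \<in> S"
        hence "g \<otimes> u \<otimes> inv u \<in> S" using u by simp
        thus "g \<in> S" using g u by (simp add: m_assoc)
      qed (use u in simp)
      have "(\<lambda>g. if g \<in> carrier G then x (g \<otimes> u) else 0) \<in> {x \<in> carrier KG. a \<otimes>\<^bsub>KG\<^esub> x = 0}"
        by (rule group_code_translate[OF G finite_G ann]) (use x u LKG in \<open>auto simp: L_def\<close>)
      moreover have "(\<lambda>g. if g \<in> carrier G then x (g \<otimes> u) else 0)
          = (\<lambda>g. if g \<in> S then x (g \<otimes> u) else 0)"
        using x iff S.subset by (auto simp: L_def fun_eq_iff)
      ultimately show ?thesis by (simp add: L_def cong: if_cong)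
    qed
  qed (use p \<open>f \<noteq> 0\<close> in \<open>auto simp: L_def\<close>)
  have "(\<Sum>h\<in>g <# S. a h) = 0" if g: "g \<in> carrier G" for g
  proof -
    \<comment> \<open>In the convolution of \<open>a\<close> with the constant \<open>c\<close> on
      \<open>S\<close>, the value at \<open>g\<close> collects exactly the left coset of
      \<open>g\<close>.\<close>
    have coset: "inv h \<otimes> g \<in> S \<longleftrightarrow> h \<in> g <# S" if "h \<in> carrier G" for h
    proof
      assume "inv h \<otimes> g \<in> S"
      hence "inv (inv h \<otimes> g) \<in> S" by (rule S.m_inv_closed)
      moreover have "g \<otimes> inv (inv h \<otimes> g) = h"
        using g that by (simp add: inv_mult_group m_assoc[symmetric])
      ultimately show "h \<in> g <# S" unfolding l_coset_def by force
    next
      assume "h \<in> g <# S"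
      then obtain s where s: "s \<in> S" "h = g \<otimes> s" by (auto simp: l_coset_def)
      hence "inv h \<otimes> g = inv s" using g by (simp add: inv_mult_group m_assoc)
      thus "inv h \<otimes> g \<in> S" using s(1) by simp
    qed
    have "0 = (a \<otimes>\<^bsub>KG\<^esub> (\<lambda>g. if g \<in> S then c else 0)) g" using c(2) by (simp add: L_def)
    also have "\<dots> = (\<Sum>h\<in>carrier G. if h \<in> g <# S then c * a h else 0)"
      using g by (auto simp: group_algebra_def coset intro!: sum.cong)
    also have "\<dots> = (\<Sum>h\<in>carrier G \<inter> (g <# S). c * a h)"
      by (simp add: sum.If_cases[OF finite_G])
    also have "carrier G \<inter> (g <# S) = g <# S"
      using l_coset_subset_G[OF S.subset g] by blast
    finally show ?thesis using c(1) by (simp flip: sum_distrib_left)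
  qed
  thus False using aug_eq_0_if_coset_sums_eq_0[OF S(1)] a(2) by blast
qed

text \<open>The elements of a Sylow subgroup are independent in \<open>KG\<close> and stay so under
  left multiplication by \<open>a\<close>, which moves them into the right ideal
  \<open>D\<close>.\<close>

lemma p_part_le_dim:
  fixes D :: "('g \<Rightarrow> 'k::field) set"
  assumes D: "group_code G D" "a \<in> D" "aug a \<noteq> 0" and p: "prime p" "CHAR('k) = p"
  shows "p ^ multiplicity p (order G) \<le> kvec.dim D"
proof -
  obtain m where "order G = p ^ multiplicity p (order G) * m"
    using multiplicity_dvd by (metis dvdE)
  from sylow_thm[OF p(1) G this finite_G]
  obtain S where S: "subgroup S G" "card S = p ^ multiplicity p (order G)" by blast
  interpret S: subgroup S G by (rule S)
  have fin: "finite S" using finite_G S.subset by (rule finite_subset[rotated])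
  interpret l: Vector_Spaces.linear kscale kscale "\<lambda>x :: 'g \<Rightarrow> 'k. a \<otimes>\<^bsub>KG\<^esub> x"
    by (rule KG_linear)
  let ?B = "basis_vec ` S :: ('g \<Rightarrow> 'k) set"
  have DKG: "D \<subseteq> carrier KG" and mult: "\<And>a b. a \<in> D \<Longrightarrow> b \<in> carrier KG \<Longrightarrow> a \<otimes>\<^bsub>KG\<^esub> b \<in> D"
    using D(1) by (auto simp: group_code_iff)
  have inj: "inj_on (basis_vec :: 'g \<Rightarrow> 'g \<Rightarrow> 'k) S"
    by (auto simp: inj_on_def basis_vec_def fun_eq_iff split: if_splits)
  have "kvec.independent ?B"
  proof (rule kvec.independent_if_scalars_zero)
    show "finite ?B" using fin by simp
    fix c x assume c: "(\<Sum>x\<in>?B. kscale (c x) x) = 0" and "x \<in> ?B"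
    then obtain s where s: "s \<in> S" "x = basis_vec s" by blast
    have "(\<Sum>x\<in>?B. kscale (c x) x) = (\<Sum>s\<in>S. kscale (c (basis_vec s)) (basis_vec s))"
      by (rule sum.reindex[OF inj, unfolded o_def])
    thus "c x = 0"
      using c s fun_cong[OF sum_kscale_basis_vec[OF fin, of "\<lambda>s. c (basis_vec s)"], of s]
      by simp
  qed
  moreover have inj_a: "inj_on (\<lambda>x. a \<otimes>\<^bsub>KG\<^esub> x) (kvec.span ?B)"
  proof -
    have "kvec.span ?B \<subseteq> {f. \<forall>g. g \<notin> S \<longrightarrow> f g = 0}"
      by (rule kvec.span_minimal)
        (auto simp: basis_vec_def kvec.subspace_def kscale_def)
    hence "f = 0" if "f \<in> kvec.span ?B" "a \<otimes>\<^bsub>KG\<^esub> f = 0" for f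
      using p_subgroup_mult_inj[OF S p, of a f] D DKG that by blast
    thus ?thesis by (auto simp: l.inj_on_iff_eq_0)
  qed
  ultimately have "kvec.independent ((\<lambda>x. a \<otimes>\<^bsub>KG\<^esub> x) ` ?B)"
    by (rule l.independent_inj_on_image)
  moreover have "(\<lambda>x. a \<otimes>\<^bsub>KG\<^esub> x) ` ?B \<subseteq> D"
    using mult[OF D(2)] basis_vec_KG S.subset by auto
  moreover have "D \<subseteq> kvec.span (basis_vec ` carrier G)"
    using DKG KG_span by blast
  ultimately have "card ((\<lambda>x. a \<otimes>\<^bsub>KG\<^esub> x) ` ?B) \<le> kvec.dim D"
    using kvec.card_le_dim_finite[of "basis_vec ` carrier G" D] finite_G by blast
  moreover have "inj_on (\<lambda>x. a \<otimes>\<^bsub>KG\<^esub> x) ?B"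
    using inj_a kvec.span_superset by (rule inj_on_subset)
  ultimately show ?thesis using inj S(2) by (simp add: card_image)
qed

end

theorem theorem3p7:
  fixes G :: "('g, 's) monoid_scheme" and C :: "('g \<Rightarrow> 'k::field) set"
  assumes "group G" and "finite (carrier G)"
    and "group_code G C" and "\<not> C \<subseteq> dual_code G C"
  shows "(\<exists>P\<^sub>0 M. rmod_direct_sum (group_algebra G) (code_rmodule G (schur_square C)) P\<^sub>0 M \<and>
            projective_cover (group_algebra G) (code_rmodule G P\<^sub>0)
              (trivial_rmodule G :: ('g \<Rightarrow> 'k, 'k) rmodule)) \<and>
         (\<forall>p::nat. prime p \<and> CHAR('k) = p \<longrightarrow>
            p ^ multiplicity p (order G) \<le> kvec.dim (schur_square C))"
proof -
  obtain v c where vc: "v \<in> C" "c \<in> C" "code_inner G v c \<noteq> 0"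
    using assms(3,4) by (auto simp: dual_code_def group_code_iff[OF assms(1,2)])
  let ?D = "schur_square C"
  have D: "group_code G ?D" using assms(1-3) by (rule group_code_schur_square)
  \<comment> \<open>The augmentation of the Schur product \<open>v * c\<close> is the inner product
    of \<open>v\<close> and \<open>c\<close>, so this one element serves both claims.\<close>
  have vc_D: "v * c \<in> ?D" unfolding schur_square_def by (rule kvec.span_base) (use vc in blast)
  have aug_vc: "aug G (v * c) \<noteq> 0"
    using vc(3) by (simp add: aug_def[OF assms(1,2)] code_inner_def)
  obtain U where U: "aug_minimal G U" "U \<subseteq> ?D"
    using aug_minimal_exists[OF assms(1,2) D vc_D aug_vc] by blast
  obtain e where e: "e \<in> U" "\<forall>x\<in>U. e \<otimes>\<^bsub>group_algebra G\<^esub> x = x"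
    using aug_minimal_idempotent[OF assms(1,2) U(1)] by blast
  have "group_code G U" using U(1) by (simp add: aug_minimal_def[OF assms(1,2)])
  \<comment> \<open>\<open>U\<close> serves as the projective cover and the annihilator of
    \<open>e\<close> in \<open>?D\<close> as its complement.\<close>
  from left_unit_direct_summand[OF assms(1,2) this D U(2) e]
    aug_minimal_projective_cover[OF assms(1,2) U(1)] p_part_le_dim[OF assms(1,2) D vc_D aug_vc]
  show ?thesis by blast
qed

end
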